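(* Let $n\ge 2$ and consider a mechanical Lagrangian with one degree of underactuation, in local coordinates $(x,\theta^2,\dots,\theta^n)$, $$L(x,\dot x,\dot\theta)=\tfrac12 g_{11}(x)\dot x^2+g_{1a}(x)\dot x\,\dot\theta^a+\tfrac12 g_{ab}\dot\theta^a\dot\theta^b-V(x),$$ where the matrix $(g_{ab})_{a,b=2}^n$ is constant, and suppose $\sigma_{ab}=\sigma g_{ab}$ for a constant $\sigma$. Let $\tau^a=\tau^a(x)$, $a=2,\dots,n$, be smooth functions satisfying the ODE system $$2\tau^a g_{1e}g^{ec}g_{1c}'+2\tau^a g_{1e}(\tau^e)'-\tau^a g_{11}'+2g_{11}(\tau^a)'-2g_{1c}g^{dc}g_{d1}(\tau^a)'-2g_{1c}\tau^c(\tau^a)'=0,\qquad a=2,\dots,n,$$ and such that the regularity assumptions stated in the context hold. Then there is a function $\tilde V(x,\theta)$ such that, for the controlled Lagrangian $\tilde L_{\tau,\sigma}=K_{\tau,\sigma}-\tilde V$, where $$K_{\tau,\sigma}=\tfrac12\left(g_{11}+2g_{1a}\tau^a+(1+\sigma)g_{ab}\tau^a\tau^b\right)\dot x^2+(g_{1a}+g_{ab}\tau^b)\dot x\,\dot\theta^a+\tfrac12 g_{ab}\dot\theta^a\dot\theta^b,$$ the Euler-Lagrange equations of $\tilde L_{\tau,\sigma}$ are equivalent to (have the same solutions as) the controlled Euler-Lagrange equations $$\frac{d}{dt}\frac{\partial L}{\partial\dot x}-\frac{\partial L}{\partial x}=0,\qquad \frac{d}{dt}\frac{\partial L}{\partial\dot\theta^a}=u_a,\qquad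 u_a=-\frac{d}{dt}\left(g_{ab}\tau^b\dot x\right),\quad a=2,\dots,n.$$ In the particular case $n=2$, for every constant $k$ the function $$\tau(x)=k\sqrt{g_{11}(x)g_{22}-g_{12}(x)^2}$$ is a solution of this ODE system (for $\tau=\tau^2$).
   Context: Conventions: repeated indices are summed; Latin indices $a,b,c,d,e$ run over $2,\dots,n$; $(g^{ab})$ is the inverse of $(g_{ab})$; $g_{a1}=g_{1a}$; a prime denotes $d/dx$. All data are smooth. The full matrix $\begin{pmatrix} g_{11}&g_{1b}\\ g_{1a}&g_{ab}\end{pmatrix}$ is the (symmetric, positive definite) matrix of a Riemannian metric in local coordinates; its coefficients and $V$ depend only on $x$, because $L$ is invariant under an Abelian Lie group with coordinates $\theta^a$. "One degree of underactuation" means there is exactly one unactuated variable, $x$. All assertions are local, in a coordinate chart (e.g. $x$ in an open interval). Regularity assumptions: (i) the matrix of second derivatives with respect to accelerations of the closed-loop system, $$\tilde C=\begin{pmatrix} g_{11}& g_{1b}\\ g_{1a}+g_{ad}\tau^d& g_{ab}\end{pmatrix},$$ is invertible, equivalently $A_{11}=g_{11}-g_{1b}g^{ab}(g_{a1}+g_{ad}\tau^d)$ is nowhere zero; (ii) the controlled Lagrangian is regular, i.e. the Hessian of $K_{\tau,\sigma}$ with respect to $(\dot x,\dot\theta^2,\dots,\dot\theta^n)$ is invertible. Here $K_{\tau,\sigma}$ is the kinetic part of $L_{\tau,\sigma}(x,\dot x,\dot\theta)=L(x,\dot x,\dot\theta^a+\tau^a\dot x)+\tfrac12\sigma_{ab}\tau^a\tau^b\dot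 x^2$ with $\sigma_{ab}=\sigma g_{ab}$. *)

theory Defs
  imports "HOL-Analysis.Analysis"
begin

section \<open>Smooth functions\<close>

text \<open>
  Intended for open sets and finite-dimensional domains. There \<open>Ck_on k S f\<close> is the usual
  \<open>f \<in> C\<^sup>k(S)\<close>: a map is \<open>C\<^sup>k\<^sup>+\<^sup>1\<close> iff it is differentiable and all its directional
  derivatives are \<open>C\<^sup>k\<close>.
\<close>

primrec Ck_on ::
    "nat \<Rightarrow> 'a::real_normed_vector set \<Rightarrow> ('a \<Rightarrow> 'b::real_normed_vector) \<Rightarrow> bool" where
  "Ck_on 0 S f \<longleftrightarrow> continuous_on S f"
| "Ck_on (Suc k) S f \<longleftrightarrow>
     (\<forall>x\<in>S. f differentiable (at x)) \<and>
     (\<forall>v. Ck_on k S (\<lambda>x. frechet_derivative f (at x) v))"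

definition smooth_on ::
    "'a::real_normed_vector set \<Rightarrow> ('a \<Rightarrow> 'b::real_normed_vector) \<Rightarrow> bool" where
  "smooth_on S f \<longleftrightarrow> (\<forall>k. Ck_on k S f)"


section \<open>Euler--Lagrange expressions\<close>

definition partial :: "'m::finite \<Rightarrow> (real^'m \<Rightarrow> real) \<Rightarrow> real^'m \<Rightarrow> real" where
  "partial i f p = deriv (\<lambda>s. f (p + s *\<^sub>R axis i 1)) 0"

definition hessian :: "(real^'m::finite \<Rightarrow> real) \<Rightarrow> real^'m \<Rightarrow> real^'m^'m" where
  "hessian f p = (\<chi> i j. partial i (partial j f) p)"

text \<open>A Lagrangian takes the configuration as its first and the velocity as its second argument.\<close>

type_synonym 'm lagrangian = "real^'m \<Rightarrow> real^'m \<Rightarrow> real"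

abbreviation velocity :: "(real \<Rightarrow> real^'m::finite) \<Rightarrow> real \<Rightarrow> real^'m" where
  "velocity q t \<equiv> vector_derivative q (at t)"

definition momentum_rate ::
    "('m::finite) lagrangian \<Rightarrow> (real \<Rightarrow> real^'m) \<Rightarrow> 'm \<Rightarrow> real \<Rightarrow> real" where
  "momentum_rate L q i t = deriv (\<lambda>s. partial i (L (q s)) (velocity q s)) t"

definition euler_lagrange ::
    "('m::finite) lagrangian \<Rightarrow> (real \<Rightarrow> real^'m) \<Rightarrow> 'm \<Rightarrow> real \<Rightarrow> real" where
  "euler_lagrange L q i t =
     momentum_rate L q i t - partial i (\<lambda>p. L p (velocity q t)) (q t)"

definition admissible_curve ::
    "(real^'m::finite) set \<Rightarrow> real set \<Rightarrow> (real \<Rightarrow> real^'m) \<Rightarrow> bool" where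
  "admissible_curve U J q \<longleftrightarrow>
     (\<forall>t\<in>J. q t \<in> U \<and> q differentiable (at t) \<and> velocity q differentiable (at t))"

definition euler_lagrange_solution ::
    "(real^'m::finite) set \<Rightarrow> 'm lagrangian \<Rightarrow> real set \<Rightarrow> (real \<Rightarrow> real^'m) \<Rightarrow> bool" where
  "euler_lagrange_solution U L J q \<longleftrightarrow>
     admissible_curve U J q \<and> (\<forall>t\<in>J. \<forall>i. euler_lagrange L q i t = 0)"


section \<open>Mechanical systems with one degree of underactuation\<close>

text \<open>
  The finite type \<open>'n\<close> plays the role of the index set \<open>{2,\<dots>,n}\<close>. The index set
  \<open>{1,\<dots>,n}\<close> is \<open>'n option\<close>, where \<open>None\<close> is the index \<open>1\<close>, so that
  \<open>n = CARD('n option)\<close>. Accordingly \<open>q $ None\<close> is the unactuated coordinate \<open>x\<close> and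
  \<open>q $ Some a\<close> is \<open>\<theta>\<^sup>a\<close>. The arguments \<open>g11\<close>, \<open>g1\<close>, \<open>G\<close> stand for
  \<open>g\<^sub>1\<^sub>1(x)\<close>, \<open>(g\<^sub>1\<^sub>a(x))\<^sub>a\<close> and the constant matrix \<open>(g\<^sub>a\<^sub>b)\<close>.
\<close>

definition block_matrix ::
    "real \<Rightarrow> real^'n::finite \<Rightarrow> real^'n \<Rightarrow> real^'n^'n \<Rightarrow> real^('n option)^('n option)" where
  "block_matrix c r l M = (\<chi> i j.
     (case i of
        None \<Rightarrow> (case j of None \<Rightarrow> c | Some b \<Rightarrow> r $ b)
      | Some a \<Rightarrow> (case j of None \<Rightarrow> l $ a | Some b \<Rightarrow> M $ a $ b)))"

definition metric_matrix ::
    "(real \<Rightarrow> real) \<Rightarrow> (real \<Rightarrow> real^'n::finite) \<Rightarrow> real^'n^'n \<Rightarrow> real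
      \<Rightarrow> real^('n option)^('n option)" where
  "metric_matrix g11 g1 G x = block_matrix (g11 x) (g1 x) (g1 x) G"

definition pos_def_matrix :: "real^'m::finite^'m \<Rightarrow> bool" where
  "pos_def_matrix M \<longleftrightarrow> transpose M = M \<and> (\<forall>v. v \<noteq> 0 \<longrightarrow> v \<bullet> (M *v v) > 0)"

definition chart :: "real set \<Rightarrow> (real^('n::finite option)) set" where
  "chart I = {q. q $ None \<in> I}"

definition mech_lagrangian ::
    "(real \<Rightarrow> real) \<Rightarrow> (real \<Rightarrow> real^'n::finite) \<Rightarrow> real^'n^'n \<Rightarrow> (real \<Rightarrow> real)
      \<Rightarrow> ('n option) lagrangian" where
  "mech_lagrangian g11 g1 G V q v =
     1/2 * g11 (q $ None) * (v $ None)\<^sup>2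
     + (\<Sum>a\<in>UNIV. g1 (q $ None) $ a * v $ None * v $ Some a)
     + 1/2 * (\<Sum>a\<in>UNIV. \<Sum>b\<in>UNIV. G $ a $ b * v $ Some a * v $ Some b)
     - V (q $ None)"

definition controlled_kinetic ::
    "(real \<Rightarrow> real) \<Rightarrow> (real \<Rightarrow> real^'n::finite) \<Rightarrow> real^'n^'n \<Rightarrow> real \<Rightarrow> (real \<Rightarrow> real^'n)
      \<Rightarrow> ('n option) lagrangian" where
  "controlled_kinetic g11 g1 G \<sigma> \<tau> q v = (let x = q $ None in
     1/2 * (g11 x + 2 * (\<Sum>a\<in>UNIV. g1 x $ a * \<tau> x $ a)
              + (1 + \<sigma>) * (\<Sum>a\<in>UNIV. \<Sum>b\<in>UNIV. G $ a $ b * \<tau> x $ a * \<tau> x $ b)) * (v $ None)\<^sup>2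
     + (\<Sum>a\<in>UNIV. (g1 x $ a + (\<Sum>b\<in>UNIV. G $ a $ b * \<tau> x $ b)) * v $ None * v $ Some a)
     + 1/2 * (\<Sum>a\<in>UNIV. \<Sum>b\<in>UNIV. G $ a $ b * v $ Some a * v $ Some b))"

text \<open>
  \<open>controlled_kinetic\<close> is the kinetic part of
  \<open>L\<^sub>\<tau>\<^sub>,\<^sub>\<sigma> = L(x, x', \<theta>'\<^sup>a + \<tau>\<^sup>a x') + 1/2 \<sigma>\<^sub>a\<^sub>b \<tau>\<^sup>a \<tau>\<^sup>b x'\<^sup>2\<close> with
  \<open>\<sigma>\<^sub>a\<^sub>b = \<sigma> g\<^sub>a\<^sub>b\<close>.
\<close>

lemma controlled_kinetic_eq:
  fixes G :: "real^'n::finite^'n" and \<tau> :: "real \<Rightarrow> real^'n"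
  assumes "transpose G = G"
  defines "shift \<equiv> \<lambda>x (v :: real^('n option)).
             (\<chi> i. case i of None \<Rightarrow> v $ None | Some a \<Rightarrow> v $ Some a + \<tau> x $ a * v $ None)"
  shows "mech_lagrangian g11 g1 G V q (shift (q $ None) v)
           + 1/2 * (\<Sum>a\<in>UNIV. \<Sum>b\<in>UNIV.
                      \<sigma> * G $ a $ b * \<tau> (q $ None) $ a * \<tau> (q $ None) $ b) * (v $ None)\<^sup>2
         = controlled_kinetic g11 g1 G \<sigma> \<tau> q v - V (q $ None)"
proof -
  define x w t y where "x = q $ None" and "w = v $ None" and "t = \<tau> x" and "y = (\<lambda>a. v $ Some a)"
  have sym: "G $ a $ b = G $ b $ a" for a b
    using assms(1) by (metis transpose_def vec_lambda_beta)
  have swap: "(\<Sum>a\<in>UNIV. \<Sum>b\<in>UNIV. G $ a $ b * (y a * t $ b))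
            = (\<Sum>a\<in>UNIV. \<Sum>b\<in>UNIV. G $ a $ b * (t $ a * y b))"
    by (subst sum.swap) (simp add: sym mult_ac)
  have quad: "(\<Sum>a\<in>UNIV. \<Sum>b\<in>UNIV. G $ a $ b * (y a + t $ a * w) * (y b + t $ b * w))
      = (\<Sum>a\<in>UNIV. \<Sum>b\<in>UNIV. G $ a $ b * y a * y b)
        + 2 * w * (\<Sum>a\<in>UNIV. \<Sum>b\<in>UNIV. G $ a $ b * (y a * t $ b))
        + w\<^sup>2 * (\<Sum>a\<in>UNIV. \<Sum>b\<in>UNIV. G $ a $ b * t $ a * t $ b)"
    (is "?l = ?A + 2 * w * ?B + w\<^sup>2 * ?C")
  proof -
    have "?l = ?A + w * ?B
            + w * (\<Sum>a\<in>UNIV. \<Sum>b\<in>UNIV. G $ a $ b * (t $ a * y b)) + w\<^sup>2 * ?C"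
      unfolding sum_distrib_left sum.distrib[symmetric]
      by (intro sum.cong refl) (simp add: algebra_simps power2_eq_square)
    then show ?thesis using swap by simp
  qed
  have lin: "(\<Sum>a\<in>UNIV. g1 x $ a * w * (y a + t $ a * w))
      = (\<Sum>a\<in>UNIV. g1 x $ a * w * y a) + w\<^sup>2 * (\<Sum>a\<in>UNIV. g1 x $ a * t $ a)"
    unfolding sum_distrib_left sum.distrib[symmetric]
    by (intro sum.cong refl) (simp add: algebra_simps power2_eq_square)
  have cross: "(\<Sum>a\<in>UNIV. (g1 x $ a + (\<Sum>b\<in>UNIV. G $ a $ b * t $ b)) * w * y a)
      = (\<Sum>a\<in>UNIV. g1 x $ a * w * y a)
        + w * (\<Sum>a\<in>UNIV. \<Sum>b\<in>UNIV. G $ a $ b * (y a * t $ b))"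
    unfolding sum_distrib_left sum.distrib[symmetric]
    by (intro sum.cong refl)
       (simp add: algebra_simps sum_distrib_left sum_distrib_right)
  have sig: "(\<Sum>a\<in>UNIV. \<Sum>b\<in>UNIV. \<sigma> * G $ a $ b * t $ a * t $ b)
      = \<sigma> * (\<Sum>a\<in>UNIV. \<Sum>b\<in>UNIV. G $ a $ b * t $ a * t $ b)"
    by (simp add: sum_distrib_left mult_ac)
  show ?thesis
    unfolding mech_lagrangian_def controlled_kinetic_def shift_def Let_def
    by (simp add: x_def[symmetric] w_def[symmetric] t_def[symmetric]
          fun_cong[OF y_def, symmetric] quad lin cross sig)
       (simp add: algebra_simps add_divide_distrib)
qed

definition controlled_lagrangian ::
    "(real \<Rightarrow> real) \<Rightarrow> (real \<Rightarrow> real^'n::finite) \<Rightarrow> real^'n^'n \<Rightarrow> real \<Rightarrow> (real \<Rightarrow> real^'n)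
      \<Rightarrow> (real^('n option) \<Rightarrow> real) \<Rightarrow> ('n option) lagrangian" where
  "controlled_lagrangian g11 g1 G \<sigma> \<tau> Vt q v = controlled_kinetic g11 g1 G \<sigma> \<tau> q v - Vt q"

definition control ::
    "real^'n::finite^'n \<Rightarrow> (real \<Rightarrow> real^'n) \<Rightarrow> (real \<Rightarrow> real^('n option)) \<Rightarrow> 'n \<Rightarrow> real \<Rightarrow> real" where
  "control G \<tau> q a t =
     - deriv (\<lambda>s. \<Sum>b\<in>UNIV. G $ a $ b * \<tau> (q s $ None) $ b * velocity q s $ None) t"

definition controlled_euler_lagrange_solution ::
    "(real^('n::finite option)) set \<Rightarrow> ('n option) lagrangian \<Rightarrow> real^'n^'n \<Rightarrow> (real \<Rightarrow> real^'n)
      \<Rightarrow> real set \<Rightarrow> (real \<Rightarrow> real^('n option)) \<Rightarrow> bool" where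
  "controlled_euler_lagrange_solution U L G \<tau> J q \<longleftrightarrow>
     admissible_curve U J q \<and>
     (\<forall>t\<in>J. euler_lagrange L q None t = 0 \<and>
            (\<forall>a. momentum_rate L q (Some a) t = control G \<tau> q a t))"

definition matching_ode_solution ::
    "real set \<Rightarrow> (real \<Rightarrow> real) \<Rightarrow> (real \<Rightarrow> real^'n::finite) \<Rightarrow> real^'n^'n
      \<Rightarrow> (real \<Rightarrow> real^'n) \<Rightarrow> bool" where
  "matching_ode_solution I g11 g1 G \<tau> \<longleftrightarrow>
     smooth_on I \<tau> \<and>
     (\<forall>x\<in>I. \<forall>a.
        2 * \<tau> x $ a * (\<Sum>e\<in>UNIV. \<Sum>c\<in>UNIV. g1 x $ e * matrix_inv G $ e $ c * deriv (\<lambda>y. g1 y $ c) x)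
        + 2 * \<tau> x $ a * (\<Sum>e\<in>UNIV. g1 x $ e * deriv (\<lambda>y. \<tau> y $ e) x)
        - \<tau> x $ a * deriv g11 x
        + 2 * g11 x * deriv (\<lambda>y. \<tau> y $ a) x
        - 2 * (\<Sum>c\<in>UNIV. \<Sum>d\<in>UNIV. g1 x $ c * matrix_inv G $ d $ c * g1 x $ d)
            * deriv (\<lambda>y. \<tau> y $ a) x
        - 2 * (\<Sum>c\<in>UNIV. g1 x $ c * \<tau> x $ c) * deriv (\<lambda>y. \<tau> y $ a) x
        = 0)"

text \<open>
  The matrix of coefficients of the accelerations in the closed-loop system. It is not symmetric:
  the control adds \<open>g\<^sub>a\<^sub>d \<tau>\<^sup>d\<close> to the first column only.
\<close>

definition closed_loop_matrix ::
    "(real \<Rightarrow> real) \<Rightarrow> (real \<Rightarrow> real^'n::finite) \<Rightarrow> real^'n^'n \<Rightarrow> (real \<Rightarrow> real^'n) \<Rightarrow> real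
      \<Rightarrow> real^('n option)^('n option)" where
  "closed_loop_matrix g11 g1 G \<tau> x = block_matrix (g11 x) (g1 x) (g1 x + G *v \<tau> x) G"

end

theory Submission
  imports Defs
begin

text \<open>
  Write \<open>b = g1\<close>, \<open>H = G\<^sup>-\<^sup>1\<close>, \<open>w = x'\<close> and \<open>y = (\<theta>'\<^sup>a)\<close>. Both the given and the controlled Lagrangian
  have the shape \<open>\<kappa>(x) w\<^sup>2/2 + w p(x) \<bullet> y + y \<bullet> G y/2 - W(x)\<close> (for the latter this holds once
  the potential is sought as a function of \<open>x\<close> alone), with \<open>(\<kappa>, p) = (g11, b)\<close> for the first and
  \<open>\<kappa> = g11 + 2 b \<bullet> \<tau> + (1 + \<sigma>) \<tau> \<bullet> G \<tau>\<close>, \<open>p = b + G \<tau>\<close> for the second. The angles \<open>\<theta>\<^sup>a\<close> are then cyclic,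
  and the prescribed control makes the \<open>\<theta>\<close>-equations of the two systems literally the same:
  \<open>((b + G \<tau>) w + G y)' = 0\<close>. So only the two \<open>x\<close>-equations have to be compared.

  Solving the common \<open>\<theta>\<close>-equation for \<open>y'\<close> and eliminating it, the two \<open>x\<close>-equations become
  \<open>A w' + B w\<^sup>2 + V' = 0\<close> and \<open>D w' + E w\<^sup>2 + W' = 0\<close>, where
  \<open>A = g11 - b \<bullet> H b - b \<bullet> \<tau>\<close> and \<open>B = g11'/2 - b \<bullet> H b' - b \<bullet> \<tau>'\<close>, while
  \<open>D = A + b \<bullet> \<tau> + \<sigma> \<tau> \<bullet> G \<tau>\<close> and \<open>E = B + b \<bullet> \<tau>' + \<sigma> \<tau> \<bullet> G \<tau>'\<close>. The ODE system says exactly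
  \<open>A \<tau>' = B \<tau>\<close> (\<open>matching_ode_iff\<close>); pairing it with \<open>b\<close> and with \<open>G \<tau>\<close> gives \<open>A E = D B\<close>
  (\<open>reduced_equations_proportional\<close>). Hence the second equation is \<open>D/A\<close> times the first as soon as
  \<open>W' = (D/A) V'\<close>, and such a smooth \<open>W\<close> exists on the interval. The two regularity assumptions are the
  nonvanishing of \<open>A\<close> and \<open>D\<close>: these numbers are Schur complements of \<open>G\<close> in the closed-loop matrix and
  in the Hessian of the controlled kinetic energy (\<open>schur_complement_nonzero\<close>).

  With a single angle and \<open>\<delta> = g11 G - b\<^sup>2\<close>, the terms \<open>b \<tau> \<tau>'\<close> cancel from \<open>A \<tau>' = B \<tau>\<close> and what remains is
  the linear equation \<open>\<delta> \<tau>' = \<delta>' \<tau>/2\<close>, whose solutions are the multiples of \<open>sqrt \<delta>\<close>.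
\<close>

section \<open>Calculus of smooth functions\<close>

lemma Ck_on_cong:
  assumes "open S" and "\<And>x. x \<in> S \<Longrightarrow> f x = g x" and "Ck_on k S f"
  shows "Ck_on k S g"
  using assms(2,3)
proof (induction k arbitrary: f g)
  case 0
  then show ?case by (simp add: continuous_on_eq)
next
  case (Suc k)
  have D: "(f has_derivative D) (at x) \<longleftrightarrow> (g has_derivative D) (at x)" if "x \<in> S" for x D
    using has_derivative_transform_within_open[OF _ assms(1) that] Suc.prems(1) by metis
  show ?case
    unfolding Ck_on.simps
  proof (intro conjI ballI allI)
    fix x assume "x \<in> S"
    then show "g differentiable (at x)"
      using Suc.prems(2) D by (auto simp: differentiable_def)
  next
    fix v
    have "frechet_derivative f (at x) v = frechet_derivative g (at x) v" if "x \<in> S" for x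
      using D[OF that] by (simp add: frechet_derivative_def)
    moreover have "Ck_on k S (\<lambda>x. frechet_derivative f (at x) v)"
      using Suc.prems(2) by simp
    ultimately show "Ck_on k S (\<lambda>x. frechet_derivative g (at x) v)"
      by (rule Suc.IH)
  qed
qed

text \<open>
  \<open>Ck_on\<close> is defined through \<open>frechet_derivative\<close>, a choice operator. This rule allows smoothness to be
  proved by induction with derivatives written in closed form.
\<close>

lemma Ck_on_SucI:
  assumes "open S" and "\<And>x. x \<in> S \<Longrightarrow> (f has_derivative f' x) (at x)"
    and "\<And>v. Ck_on k S (\<lambda>x. f' x v)"
  shows "Ck_on (Suc k) S f"
  unfolding Ck_on.simps
proof (intro conjI ballI allI)
  fix x assume "x \<in> S"
  then show "f differentiable (at x)" using assms(2) by (auto simp: differentiable_def)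
next
  fix v
  show "Ck_on k S (\<lambda>x. frechet_derivative f (at x) v)"
    by (rule Ck_on_cong[OF assms(1) _ assms(3)[of v]]) (simp add: frechet_derivative_at[OF assms(2), symmetric])
qed

lemma Ck_on_SucD:
  "Ck_on (Suc k) S f \<Longrightarrow> x \<in> S \<Longrightarrow> (f has_derivative frechet_derivative f (at x)) (at x)"
  by (simp add: frechet_derivative_works)

lemma Ck_on_Suc_imp: "Ck_on (Suc k) S f \<Longrightarrow> Ck_on k S f"
proof (induction k arbitrary: f)
  case 0
  then show ?case
    by (auto intro!: continuous_at_imp_continuous_on differentiable_imp_continuous_within)
next
  case (Suc k)
  then show ?case by simp
qed

lemma Ck_on_const: "Ck_on k S (\<lambda>x. c)"
  by (induction k arbitrary: c) auto

lemma Ck_on_bounded_linear: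
  assumes "bounded_linear h" and "open S" and "Ck_on k S f"
  shows "Ck_on k S (\<lambda>x. h (f x))"
  using assms(3)
proof (induction k arbitrary: f)
  case 0
  then show ?case using bounded_linear.continuous_on[OF assms(1)] by auto
next
  case (Suc k)
  show ?case
  proof (rule Ck_on_SucI[OF assms(2)])
    show "((\<lambda>x. h (f x)) has_derivative (\<lambda>v. h (frechet_derivative f (at x) v))) (at x)"
      if "x \<in> S" for x
      using bounded_linear.has_derivative[OF assms(1) Ck_on_SucD[OF Suc.prems that]] .
    show "Ck_on k S (\<lambda>x. h (frechet_derivative f (at x) v))" for v
      using Suc by simp
  qed
qed

lemma Ck_on_add:
  assumes "open S" and "Ck_on k S f" and "Ck_on k S g"
  shows "Ck_on k S (\<lambda>x. f x + g x)"
  using assms(2,3)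
proof (induction k arbitrary: f g)
  case 0
  then show ?case by (auto intro: continuous_on_add)
next
  case (Suc k)
  show ?case
  proof (rule Ck_on_SucI[OF assms(1)])
    show "((\<lambda>x. f x + g x) has_derivative
        (\<lambda>v. frechet_derivative f (at x) v + frechet_derivative g (at x) v)) (at x)"
      if "x \<in> S" for x
      using has_derivative_add[OF Ck_on_SucD[OF Suc.prems(1) that] Ck_on_SucD[OF Suc.prems(2) that]] .
    show "Ck_on k S (\<lambda>x. frechet_derivative f (at x) v + frechet_derivative g (at x) v)" for v
      using Suc by simp
  qed
qed

text \<open>
  By the Leibniz rule the derivative is a sum of two products of the same kind, whose factors are
  \<open>C\<^sup>k\<close>, so the induction has to be generalised over both factors.
\<close>

lemma Ck_on_bilinear:
  assumes "bounded_bilinear B" and "open S" and "Ck_on k S f" and "Ck_on k S g"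
  shows "Ck_on k S (\<lambda>x. B (f x) (g x))"
  using assms(3,4)
proof (induction k arbitrary: f g)
  case 0
  then show ?case using bounded_bilinear.continuous_on[OF assms(1)] by auto
next
  case (Suc k)
  show ?case
  proof (rule Ck_on_SucI[OF assms(2)])
    show "((\<lambda>x. B (f x) (g x)) has_derivative
        (\<lambda>v. B (f x) (frechet_derivative g (at x) v) + B (frechet_derivative f (at x) v) (g x))) (at x)"
      if "x \<in> S" for x
      using bounded_bilinear.FDERIV[OF assms(1) Ck_on_SucD[OF Suc.prems(1) that]
          Ck_on_SucD[OF Suc.prems(2) that]] .
    show "Ck_on k S (\<lambda>x. B (f x) (frechet_derivative g (at x) v)
        + B (frechet_derivative f (at x) v) (g x))" for v
      using Suc.prems by (intro Ck_on_add[OF assms(2)] Suc.IH Ck_on_Suc_imp[OF Suc.prems(1)]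
          Ck_on_Suc_imp[OF Suc.prems(2)]) auto
  qed
qed

lemma frechet_derivative_real_field:
  fixes \<phi> :: "real \<Rightarrow> real"
  assumes "\<phi> differentiable (at y)"
  shows "(\<phi> has_real_derivative frechet_derivative \<phi> (at y) 1) (at y)"
proof -
  have D: "(\<phi> has_derivative frechet_derivative \<phi> (at y)) (at y)"
    using assms by (simp add: frechet_derivative_works)
  have "frechet_derivative \<phi> (at y) h = frechet_derivative \<phi> (at y) 1 * h" for h
    using linear_cmul[OF has_derivative_linear[OF D], of h 1] by simp
  then show ?thesis
    using D by (metis has_field_derivative_def ext)
qed

text \<open>
  The chain rule writes the derivative as \<open>(\<phi>' \<circ> f) * f'\<close>. The outer function changes to \<open>\<phi>'\<close> in the
  induction step while the inner one stays fixed. A real outer function is the only case that occurs: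
  reciprocals, square roots, and functions of one coordinate.
\<close>

lemma Ck_on_compose_real:
  fixes \<phi> :: "real \<Rightarrow> real"
  assumes "open S" and "Ck_on k T \<phi>" and "Ck_on k S f" and "f ` S \<subseteq> T"
  shows "Ck_on k S (\<lambda>x. \<phi> (f x))"
  using assms(2,3)
proof (induction k arbitrary: \<phi>)
  case 0
  then have "continuous_on T \<phi>" "continuous_on S f" by simp_all
  then show ?case using continuous_on_compose2[OF _ _ assms(4)] by simp
next
  case (Suc k)
  let ?\<phi>' = "\<lambda>y. frechet_derivative \<phi> (at y) 1"
  show ?case
  proof (rule Ck_on_SucI[OF assms(1)])
    show "((\<lambda>x. \<phi> (f x)) has_derivative (\<lambda>v. ?\<phi>' (f x) * frechet_derivative f (at x) v)) (at x)"
      if "x \<in> S" for x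
    proof -
      have "f x \<in> T" using assms(4) that by auto
      then have "(\<phi> has_real_derivative ?\<phi>' (f x)) (at (f x))"
        using Suc.prems(1) by (intro frechet_derivative_real_field) simp
      then have "(\<phi> has_derivative (\<lambda>h. ?\<phi>' (f x) * h)) (at (f x))"
        by (simp only: has_field_derivative_def)
      from has_derivative_compose[OF Ck_on_SucD[OF Suc.prems(2) that] this]
      show ?thesis .
    qed
    have "Ck_on k S (\<lambda>x. ?\<phi>' (f x))"
      using Suc.prems(1) by (intro Suc.IH[OF _ Ck_on_Suc_imp[OF Suc.prems(2)]]) simp
    moreover have "Ck_on k S (\<lambda>x. frechet_derivative f (at x) v)" for v
      using Suc.prems(2) by simp
    ultimately show "Ck_on k S (\<lambda>x. ?\<phi>' (f x) * frechet_derivative f (at x) v)" for v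
      by (rule Ck_on_bilinear[OF bounded_bilinear_mult assms(1)])
  qed
qed

lemma Ck_on_Suc_realI:
  fixes f :: "real \<Rightarrow> real"
  assumes "open S" and "\<And>x. x \<in> S \<Longrightarrow> (f has_real_derivative f' x) (at x)" and "Ck_on k S f'"
  shows "Ck_on (Suc k) S f"
proof (rule Ck_on_SucI[OF assms(1)])
  show "(f has_derivative (\<lambda>v. f' x * v)) (at x)" if "x \<in> S" for x
    using assms(2)[OF that] by (simp add: has_field_derivative_def)
  show "Ck_on k S (\<lambda>x. f' x * v)" for v
    using Ck_on_bilinear[OF bounded_bilinear_mult assms(1,3) Ck_on_const] .
qed

text \<open>
  The derivative \<open>- inverse\<^sup>2\<close> is a polynomial in the function itself, so \<open>C\<^sup>k\<close> bootstraps to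
  \<open>C\<^sup>k\<^sup>+\<^sup>1\<close>. The same mechanism gives the square root, whose derivative is \<open>inverse (sqrt x)/2\<close>.
\<close>

lemma Ck_on_inverse: "Ck_on k (- {0}) (inverse :: real \<Rightarrow> real)"
proof (induction k)
  case 0
  show ?case by (auto intro!: continuous_intros)
next
  case (Suc k)
  have o: "open (- {0::real})" by auto
  have "Ck_on k (- {0}) (\<lambda>x::real. (-1) * (inverse x * inverse x))"
    by (intro Ck_on_bilinear[OF bounded_bilinear_mult o] Ck_on_const Suc)
  then show ?case
    by (rule Ck_on_Suc_realI[OF o, rotated])
      (auto intro!: derivative_eq_intros simp: power2_eq_square)
qed

lemma Ck_on_sqrt: "Ck_on k {0<..} sqrt"
proof (induction k)
  case 0
  show ?case by (auto intro!: continuous_intros)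
next
  case (Suc k)
  have o: "open {0::real<..}" by auto
  have "Ck_on k {0<..} (\<lambda>x. inverse (sqrt x))"
    by (rule Ck_on_compose_real[OF o Ck_on_inverse Suc]) auto
  then have c: "Ck_on k {0<..} (\<lambda>x. inverse (sqrt x) * (1/2))"
    by (intro Ck_on_bilinear[OF bounded_bilinear_mult o] Ck_on_const)
  have d: "(sqrt has_real_derivative inverse (sqrt x) * (1/2)) (at x)" if "x \<in> {0<..}" for x
    using DERIV_real_sqrt[of x] that by simp
  show ?case
    by (rule Ck_on_Suc_realI[OF o d c])
qed

lemma smooth_on_const: "smooth_on S (\<lambda>x. c)"
  by (simp add: smooth_on_def Ck_on_const)

lemma smooth_on_add:
  "open S \<Longrightarrow> smooth_on S f \<Longrightarrow> smooth_on S g \<Longrightarrow> smooth_on S (\<lambda>x. f x + g x)"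
  by (simp add: smooth_on_def Ck_on_add)

lemma smooth_on_bounded_linear:
  "bounded_linear h \<Longrightarrow> open S \<Longrightarrow> smooth_on S f \<Longrightarrow> smooth_on S (\<lambda>x. h (f x))"
  by (simp add: smooth_on_def Ck_on_bounded_linear)

lemma smooth_on_bilinear:
  "bounded_bilinear B \<Longrightarrow> open S \<Longrightarrow> smooth_on S f \<Longrightarrow> smooth_on S g
    \<Longrightarrow> smooth_on S (\<lambda>x. B (f x) (g x))"
  by (simp add: smooth_on_def Ck_on_bilinear)

lemma smooth_on_diff:
  assumes "open S" "smooth_on S f" "smooth_on S g"
  shows "smooth_on S (\<lambda>x. f x - g x)"
  using smooth_on_add[OF assms(1,2)
      smooth_on_bounded_linear[OF bounded_linear_minus[OF bounded_linear_ident] assms(1,3)]]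
  by simp

lemmas smooth_on_mult = smooth_on_bilinear[OF bounded_bilinear_mult]
lemmas smooth_on_inner = smooth_on_bilinear[OF bounded_bilinear_inner]

lemma smooth_on_matrix_vector_mult:
  fixes f :: "'a::real_normed_vector \<Rightarrow> real^'n::finite"
  shows "open S \<Longrightarrow> smooth_on S f \<Longrightarrow> smooth_on S (\<lambda>x. M *v f x)"
  by (rule smooth_on_bounded_linear[OF matrix_vector_mul_bounded_linear])

lemma smooth_on_compose_real:
  fixes \<phi> :: "real \<Rightarrow> real"
  shows "open S \<Longrightarrow> smooth_on T \<phi> \<Longrightarrow> smooth_on S f \<Longrightarrow> f ` S \<subseteq> T \<Longrightarrow> smooth_on S (\<lambda>x. \<phi> (f x))"
  unfolding smooth_on_def by (blast intro: Ck_on_compose_real)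

lemma smooth_on_divide:
  fixes f g :: "'a::real_normed_vector \<Rightarrow> real"
  assumes "open S" "smooth_on S f" "smooth_on S g" "\<And>x. x \<in> S \<Longrightarrow> g x \<noteq> 0"
  shows "smooth_on S (\<lambda>x. f x / g x)"
proof -
  have "smooth_on S (\<lambda>x. inverse (g x))"
    using assms(4)
    by (intro smooth_on_compose_real[OF assms(1) _ assms(3), where T = "- {0}"])
      (auto simp: smooth_on_def Ck_on_inverse)
  then show ?thesis
    using smooth_on_mult[OF assms(1,2)] by (simp add: divide_inverse)
qed

lemma smooth_on_sqrt:
  assumes "open S" "smooth_on S f" "\<And>x. x \<in> S \<Longrightarrow> f x > 0"
  shows "smooth_on S (\<lambda>x. sqrt (f x))"
  using assms(3)
  by (intro smooth_on_compose_real[OF assms(1) _ assms(2), where T = "{0<..}"])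
    (auto simp: smooth_on_def Ck_on_sqrt)

lemma smooth_on_vec_nth:
  fixes S :: "(real^'n::finite) set"
  assumes "open S"
  shows "smooth_on S (\<lambda>q. q $ i)"
  unfolding smooth_on_def
proof
  fix k
  have d: "((\<lambda>q::real^'n. q $ i) has_derivative (\<lambda>v. v $ i)) (at x)" for x
    by (rule bounded_linear_imp_has_derivative) (rule bounded_linear_vec_nth)
  have c: "Ck_on (Suc k) S (\<lambda>q. q $ i)" for k
    by (rule Ck_on_SucI[OF assms d Ck_on_const])
  show "Ck_on k S (\<lambda>q. q $ i)" by (rule Ck_on_Suc_imp[OF c])
qed

lemma smooth_on_imp_differentiable:
  "smooth_on S f \<Longrightarrow> x \<in> S \<Longrightarrow> f differentiable (at x)"
  unfolding smooth_on_def using Ck_on.simps(2) by blast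

lemma smooth_on_real_has_derivative:
  fixes f :: "real \<Rightarrow> real"
  assumes "smooth_on S f" and "x \<in> S"
  shows "(f has_real_derivative deriv f x) (at x)"
  using smooth_on_imp_differentiable[OF assms] real_differentiable_def DERIV_imp_deriv by metis

lemma smooth_on_has_vector_derivative:
  fixes f :: "real \<Rightarrow> 'b::real_normed_vector"
  assumes "smooth_on S f" and "x \<in> S"
  shows "(f has_vector_derivative vector_derivative f (at x)) (at x)"
  using smooth_on_imp_differentiable[OF assms] by (simp add: vector_derivative_works)

lemma smooth_on_imp_continuous: "smooth_on S f \<Longrightarrow> continuous_on S f"
  unfolding smooth_on_def using Ck_on.simps(1) by blast

lemma smooth_on_deriv:
  fixes f :: "real \<Rightarrow> real"
  assumes "open S" and "smooth_on S f"
  shows "smooth_on S (deriv f)"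
  unfolding smooth_on_def
proof
  fix k
  have "Ck_on k S (\<lambda>x. frechet_derivative f (at x) 1)"
    using assms(2) by (simp add: smooth_on_def) (metis Ck_on.simps(2))
  then show "Ck_on k S (deriv f)"
    by (rule Ck_on_cong[OF assms(1), rotated])
      (simp add: DERIV_imp_deriv[OF frechet_derivative_real_field[OF smooth_on_imp_differentiable[OF assms(2)]]])
qed

lemma smooth_on_antiderivative:
  fixes f :: "real \<Rightarrow> real"
  assumes "open S" and "\<And>x. x \<in> S \<Longrightarrow> (F has_real_derivative f x) (at x)" and "smooth_on S f"
  shows "smooth_on S F"
  unfolding smooth_on_def
proof
  fix k
  have "Ck_on (Suc k) S F"
    using Ck_on_Suc_realI[OF assms(1,2)] assms(3) by (simp add: smooth_on_def)
  then show "Ck_on k S F" by (rule Ck_on_Suc_imp)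
qed

text \<open>
  The integral from a base point of \<open>I\<close> is an antiderivative; around any point the fundamental theorem is
  applied on a compact subinterval that contains both that point and the base point in its interior.
\<close>

lemma open_interval_antiderivative:
  fixes f :: "real \<Rightarrow> real"
  assumes "open I" and "is_interval I" and "continuous_on I f"
  obtains F where "\<And>x. x \<in> I \<Longrightarrow> (F has_real_derivative f x) (at x)"
proof (cases "I = {}")
  case False
  then obtain c where c: "c \<in> I" by auto
  define F where "F = (\<lambda>u. LBINT y=ereal c..ereal u. f y)"
  have "(F has_real_derivative f x) (at x)" if x: "x \<in> I" for x
  proof -
    have below: "\<exists>a. a < y \<and> a \<in> I" and above: "\<exists>b. b > y \<and> b \<in> I" if y: "y \<in> I" for y
    proof -
      obtain e where e: "e > 0" "cball y e \<subseteq> I"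
        using assms(1) y open_contains_cball by blast
      have "y - e \<in> I" "y + e \<in> I" using e by (auto simp: dist_real_def subset_iff)
      then show "\<exists>a. a < y \<and> a \<in> I" "\<exists>b. b > y \<and> b \<in> I"
        using e(1) by (auto intro: exI[of _ "y - e"] exI[of _ "y + e"])
    qed
    have "min c x \<in> I" "max c x \<in> I" using c x by (auto simp: min_def max_def)
    obtain a where a: "a < min c x" "a \<in> I"
      using below[OF \<open>min c x \<in> I\<close>] by blast
    obtain b where b: "max c x < b" "b \<in> I"
      using above[OF \<open>max c x \<in> I\<close>] by blast
    note ab = a b
    have "{a..b} \<subseteq> I"
      using assms(2) ab(2,4) unfolding is_interval_1 atLeastAtMost_iff subset_iff by blast
    then have "continuous_on {a..b} f" using assms(3) continuous_on_subset by blast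
    then have "(F has_vector_derivative f x) (at x within {a..b})"
      unfolding F_def using ab by (intro interval_integral_FTC2) auto
    moreover have "at x within {a..b} = at x"
      using ab by (intro at_within_interior) auto
    ultimately show ?thesis
      by (simp add: has_real_derivative_iff_has_vector_derivative)
  qed
  then show ?thesis by (rule that)
qed (auto intro: that)

section \<open>Linear algebra\<close>

definition fibre_part :: "real^('n::finite option) \<Rightarrow> real^'n" where
  "fibre_part v = (\<chi> a. v $ Some a)"

lemma fibre_part_nth [simp]: "fibre_part v $ a = v $ Some a"
  by (simp add: fibre_part_def)

lemma fibre_part_zero: "fibre_part 0 = 0"
  by (simp add: vec_eq_iff)

lemma bounded_linear_fibre_part: "bounded_linear fibre_part"
  unfolding linear_conv_bounded_linear[symmetric]
  by (rule linearI) (simp_all add: vec_eq_iff)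

lemma sum_option: "(\<Sum>i\<in>(UNIV :: 'n::finite option set). f i) = f None + (\<Sum>a\<in>UNIV. f (Some a))"
  by (simp add: UNIV_option_conv sum.reindex)

lemma inner_option:
  fixes u v :: "real^('n::finite option)"
  shows "u \<bullet> v = u $ None * v $ None + fibre_part u \<bullet> fibre_part v"
  by (simp add: inner_vec_def sum_option)

lemma block_matrix_mult_None:
  "(block_matrix c r l M *v v) $ None = c * v $ None + r \<bullet> fibre_part v"
  by (simp add: matrix_vector_mult_def block_matrix_def sum_option inner_vec_def)

lemma fibre_part_block_matrix_mult:
  "fibre_part (block_matrix c r l M *v v) = v $ None *\<^sub>R l + M *v fibre_part v"
  by (simp add: vec_eq_iff matrix_vector_mult_def block_matrix_def sum_option)

lemma vec_option_eq_iff: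
  fixes u v :: "real^('n::finite option)"
  shows "u = v \<longleftrightarrow> u $ None = v $ None \<and> fibre_part u = fibre_part v"
  by (auto simp: vec_eq_iff split_option_all)

lemma matrix_vector_mult_minus_right:
  fixes M :: "real^'n::finite^'m::finite"
  shows "M *v (- v) = - (M *v v)"
  by (simp add: matrix_vector_mult_def vec_eq_iff sum_negf)

lemma matrix_inv_cancel_right:
  fixes M :: "real^'n::finite^'n"
  assumes "invertible M"
  shows "M *v (matrix_inv M *v v) = v"
proof -
  have "M ** matrix_inv M = mat 1"
    using assms unfolding invertible_def matrix_inv_def by (metis (mono_tags, lifting) someI_ex)
  then show ?thesis by (simp add: matrix_vector_mul_assoc)
qed

lemma matrix_inv_cancel_left:
  fixes M :: "real^'n::finite^'n"
  assumes "invertible M"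
  shows "matrix_inv M *v (M *v v) = v"
proof -
  have "matrix_inv M ** M = mat 1"
    using assms unfolding invertible_def matrix_inv_def by (metis (mono_tags, lifting) someI_ex)
  then show ?thesis by (simp add: matrix_vector_mul_assoc)
qed

text \<open>
  If the Schur complement of \<open>M\<close> vanished, \<open>(1, - M\<^sup>-\<^sup>1 l)\<close> would lie in the kernel of the block matrix.
  Both regularity assumptions enter the proof through this fact.
\<close>

lemma schur_complement_nonzero:
  fixes M :: "real^'n::finite^'n"
  assumes "invertible M" and "invertible (block_matrix c r l M)"
  shows "c - r \<bullet> (matrix_inv M *v l) \<noteq> 0"
proof
  assume z: "c - r \<bullet> (matrix_inv M *v l) = 0"
  define v :: "real^('n option)"
    where "v = (\<chi> i. case i of None \<Rightarrow> 1 | Some a \<Rightarrow> - (matrix_inv M *v l) $ a)"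
  have v: "v $ None = 1" "fibre_part v = - (matrix_inv M *v l)"
    by (simp_all add: v_def vec_eq_iff)
  have "M *v (- (matrix_inv M *v l)) = - l"
    using matrix_inv_cancel_right[OF assms(1), of l]
    by (simp add: matrix_vector_mult_minus_right)
  then have "block_matrix c r l M *v v = 0"
    using z by (simp add: vec_option_eq_iff block_matrix_mult_None fibre_part_block_matrix_mult v
        fibre_part_zero)
  then have "v = 0"
    using assms(2) by (metis invertible_left_inverse matrix_left_invertible_ker)
  then show False using v(1) by simp
qed

lemma inner_symmetric_matrix:
  fixes M :: "real^'n::finite^'n"
  assumes "transpose M = M"
  shows "u \<bullet> (M *v v) = (M *v u) \<bullet> v"
  using dot_lmul_matrix[of u M v] assms by (simp add: vector_transpose_matrix[symmetric] del: vector_transpose_matrix)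

lemma sum_sum_matrix:
  fixes G :: "real^'n::finite^'n"
  shows "(\<Sum>a\<in>UNIV. \<Sum>b\<in>UNIV. G $ a $ b * u $ a * v $ b) = u \<bullet> (G *v v)"
  by (simp add: inner_vec_def matrix_vector_mult_def sum_distrib_left mult_ac)

lemma pos_def_block:
  assumes "pos_def_matrix (block_matrix c r l M)"
  shows "transpose M = M" and "u \<noteq> 0 \<Longrightarrow> u \<bullet> (M *v u) > 0" and "invertible M"
proof -
  let ?B = "block_matrix c r l M"
  have sym: "?B $ i $ j = ?B $ j $ i" for i j
  proof -
    have "?B $ i $ j = transpose ?B $ j $ i" by (simp add: transpose_def)
    also have "transpose ?B = ?B" using assms by (simp only: pos_def_matrix_def)
    finally show ?thesis .
  qed
  show "transpose M = M"
    using sym[of "Some _" "Some _"] by (simp add: block_matrix_def transpose_def vec_eq_iff)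
  show pos: "u \<bullet> (M *v u) > 0" if "u \<noteq> 0" for u
  proof -
    define v :: "real^('a option)" where "v = (\<chi> i. case i of None \<Rightarrow> 0 | Some a \<Rightarrow> u $ a)"
    have v: "v $ None = 0" "fibre_part v = u" by (simp_all add: v_def vec_eq_iff)
    then have "v \<noteq> 0" using that fibre_part_zero by metis
    then have "v \<bullet> (?B *v v) > 0" using assms by (simp add: pos_def_matrix_def)
    then show ?thesis by (simp add: inner_option fibre_part_block_matrix_mult v)
  qed
  then have "M *v u = 0 \<Longrightarrow> u = 0" for u by force
  then show "invertible M"
    by (metis invertible_left_inverse matrix_left_invertible_ker)
qed

section \<open>Euler--Lagrange expressions of a mechanical Lagrangian with cyclic variables\<close>

lemma mech_lagrangian_inner:
  "mech_lagrangian \<kappa> p G W q v =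
     1/2 * \<kappa> (q $ None) * (v $ None)\<^sup>2 + v $ None * (p (q $ None) \<bullet> fibre_part v)
     + 1/2 * (fibre_part v \<bullet> (G *v fibre_part v)) - W (q $ None)"
  unfolding mech_lagrangian_def sum_sum_matrix[of G "fibre_part v" "fibre_part v", symmetric]
  by (simp add: inner_vec_def sum_distrib_left mult_ac)

text \<open>
  A mechanical Lagrangian is a quadratic polynomial along every coordinate line in velocity space, so its
  partial derivatives can be read off as linear coefficients.
\<close>

lemma deriv_quadratic_0:
  fixes f :: "real \<Rightarrow> real"
  assumes "\<And>s. f s = c0 + c1 * s + c2 * s\<^sup>2"
  shows "deriv f 0 = c1"
proof -
  have f: "f = (\<lambda>s. c0 + c1 * s + c2 * s\<^sup>2)" using assms by auto
  show ?thesis unfolding f by (rule DERIV_imp_deriv) (auto intro!: derivative_eq_intros)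
qed

lemma fibre_part_shift:
  "fibre_part (v + s *\<^sub>R axis None 1) = fibre_part v"
  "fibre_part (v + s *\<^sub>R axis (Some a) 1) = fibre_part v + s *\<^sub>R axis a 1"
  by (simp_all add: vec_eq_iff axis_def)

lemma None_shift:
  fixes v :: "real^('n::finite option)"
  shows "(v + s *\<^sub>R axis None 1) $ None = v $ None + s"
    and "(v + s *\<^sub>R axis (Some a) 1) $ None = v $ None"
  by (simp_all add: axis_def)

lemma partial_velocity_None:
  "partial None (mech_lagrangian \<kappa> p G W q) v
    = \<kappa> (q $ None) * v $ None + p (q $ None) \<bullet> fibre_part v"
  unfolding partial_def
  by (rule deriv_quadratic_0[where ?c0.0 = "mech_lagrangian \<kappa> p G W q v"
        and ?c2.0 = "1/2 * \<kappa> (q $ None)"])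
    (simp add: mech_lagrangian_inner fibre_part_shift None_shift del: vector_add_component,
      simp add: algebra_simps power2_eq_square)

lemma partial_velocity_Some:
  assumes "transpose G = G"
  shows "partial (Some a) (mech_lagrangian \<kappa> p G W q) v
    = p (q $ None) $ a * v $ None + (G *v fibre_part v) $ a"
proof -
  have *: "fibre_part v \<bullet> (G *v axis a 1) = (G *v fibre_part v) $ a"
    using inner_symmetric_matrix[OF assms] by (simp add: inner_axis)
  show ?thesis
    unfolding partial_def
    by (rule deriv_quadratic_0[where ?c0.0 = "mech_lagrangian \<kappa> p G W q v"
          and ?c2.0 = "1/2 * (axis a 1 \<bullet> (G *v axis a 1))"])
      (simp add: mech_lagrangian_inner fibre_part_shift None_shift inner_add inner_axis
        matrix_vector_right_distrib matrix_vector_mult_scaleR * inner_axis' del: vector_add_component,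
        simp add: algebra_simps power2_eq_square)
qed

lemma partial_position_None:
  assumes "(\<kappa> has_real_derivative \<kappa>') (at (q $ None))"
    and "(p has_vector_derivative p') (at (q $ None))"
    and "(W has_real_derivative W') (at (q $ None))"
  shows "partial None (\<lambda>r. mech_lagrangian \<kappa> p G W r v) q
    = 1/2 * \<kappa>' * (v $ None)\<^sup>2 + v $ None * (p' \<bullet> fibre_part v) - W'"
proof -
  have d: "((\<lambda>y. 1/2 * \<kappa> y * (v $ None)\<^sup>2 + v $ None * (p y \<bullet> fibre_part v)
      + 1/2 * (fibre_part v \<bullet> (G *v fibre_part v)) - W y) has_real_derivative
      1/2 * \<kappa>' * (v $ None)\<^sup>2 + v $ None * (p' \<bullet> fibre_part v) - W') (at (q $ None))"
    using assms
    by (auto intro!: derivative_eq_intros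
        bounded_linear.has_vector_derivative[OF bounded_linear_inner_left]
        simp: has_real_derivative_iff_has_vector_derivative[of "\<lambda>y. p y \<bullet> _"])
  then show ?thesis
    unfolding partial_def mech_lagrangian_inner None_shift
    by (intro DERIV_imp_deriv) (use DERIV_shift[of _ _ 0 "q $ None"] in \<open>simp add: add.commute\<close>)
qed

lemma partial_position_Some:
  "partial (Some a) (\<lambda>r. mech_lagrangian \<kappa> p G W r v) q = 0"
  unfolding partial_def mech_lagrangian_inner None_shift by simp

text \<open>
  The momenta are linear in the velocity with the kinetic matrix as coefficients; in particular the
  Hessian is the same at all velocities.
\<close>

lemma hessian_mech_lagrangian:
  assumes "transpose G = G"
  shows "hessian (mech_lagrangian \<kappa> p G W q) v = metric_matrix \<kappa> p G (q $ None)"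
proof -
  have sym: "G $ a $ b = G $ b $ a" for a b
    using assms by (metis transpose_def vec_lambda_beta)
  let ?M = "metric_matrix \<kappa> p G (q $ None)"
  have part: "partial j (mech_lagrangian \<kappa> p G W q) = (\<lambda>v. (?M *v v) $ j)" for j
  proof (cases j)
    case None
    then show ?thesis
      by (auto simp: partial_velocity_None block_matrix_mult_None metric_matrix_def)
  next
    case (Some a)
    have "(?M *v v) $ Some a = fibre_part (?M *v v) $ a" for v by simp
    then show ?thesis
      unfolding metric_matrix_def fibre_part_block_matrix_mult Some
      by (auto simp: partial_velocity_Some[OF assms])
  qed
  have "partial i (\<lambda>v. (?M *v v) $ j) v = ?M $ j $ i" for i j
    unfolding partial_def
    by (rule deriv_quadratic_0[where ?c0.0 = "(?M *v v) $ j" and ?c2.0 = 0])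
      (simp add: matrix_vector_right_distrib matrix_vector_mult_scaleR
        matrix_vector_mult_basis column_def)
  moreover have "?M $ j $ i = ?M $ i $ j" for i j
    by (simp add: metric_matrix_def block_matrix_def sym split: option.split)
  ultimately show ?thesis
    by (simp add: hessian_def part vec_eq_iff)
qed

text \<open>
  The two functions are the momenta of a mechanical Lagrangian, conjugate to \<open>x\<close> and to the angles,
  evaluated along a curve. A twice differentiable curve is enough, although the coefficients are composed
  with it, since the momenta contain first derivatives only.
\<close>

lemma momentum_derivatives:
  fixes q :: "real \<Rightarrow> real^('n::finite option)"
  assumes "q differentiable (at t)" and "velocity q differentiable (at t)"
    and "(\<kappa> has_real_derivative \<kappa>') (at (q t $ None))"
    and "(p has_vector_derivative p') (at (q t $ None))"
  defines "v \<equiv> velocity q t" and "\<alpha> \<equiv> vector_derivative (velocity q) (at t)"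
  shows "((\<lambda>s. \<kappa> (q s $ None) * velocity q s $ None + p (q s $ None) \<bullet> fibre_part (velocity q s))
      has_real_derivative
        (\<kappa> (q t $ None) * \<alpha> $ None + \<kappa>' * (v $ None)\<^sup>2
          + p (q t $ None) \<bullet> fibre_part \<alpha> + v $ None * (p' \<bullet> fibre_part v))) (at t)"
    and "((\<lambda>s. velocity q s $ None *\<^sub>R p (q s $ None) + G *v fibre_part (velocity q s))
      has_vector_derivative
        (\<alpha> $ None *\<^sub>R p (q t $ None) + (v $ None)\<^sup>2 *\<^sub>R p' + G *v fibre_part \<alpha>)) (at t)"
proof -
  have q: "(q has_vector_derivative v) (at t)"
    and v: "(velocity q has_vector_derivative \<alpha>) (at t)"
    using assms(1,2) by (simp_all add: v_def \<alpha>_def vector_derivative_works)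
  have x: "((\<lambda>s. q s $ None) has_real_derivative v $ None) (at t)"
    and w: "((\<lambda>s. velocity q s $ None) has_real_derivative \<alpha> $ None) (at t)"
    unfolding has_real_derivative_iff_has_vector_derivative
    by (rule bounded_linear.has_vector_derivative[OF bounded_linear_vec_nth]; fact)+
  have y: "((\<lambda>s. fibre_part (velocity q s)) has_vector_derivative fibre_part \<alpha>) (at t)"
    by (rule bounded_linear.has_vector_derivative[OF bounded_linear_fibre_part v])
  have \<kappa>: "((\<lambda>s. \<kappa> (q s $ None)) has_real_derivative \<kappa>' * v $ None) (at t)"
    using DERIV_chain2[OF assms(3) x] .
  have p: "((\<lambda>s. p (q s $ None)) has_vector_derivative v $ None *\<^sub>R p') (at t)"
    using vector_diff_chain_at[OF x[unfolded has_real_derivative_iff_has_vector_derivative] assms(4)]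
    by (simp add: o_def)
  have "((\<lambda>s. p (q s $ None) \<bullet> fibre_part (velocity q s)) has_real_derivative
      p (q t $ None) \<bullet> fibre_part \<alpha> + (v $ None *\<^sub>R p') \<bullet> fibre_part v) (at t)"
    using bounded_bilinear.has_vector_derivative[OF bounded_bilinear_inner p y]
    by (simp add: has_real_derivative_iff_has_vector_derivative v_def)
  from DERIV_add[OF DERIV_mult[OF \<kappa> w] this]
  show "((\<lambda>s. \<kappa> (q s $ None) * velocity q s $ None + p (q s $ None) \<bullet> fibre_part (velocity q s))
      has_real_derivative
        (\<kappa> (q t $ None) * \<alpha> $ None + \<kappa>' * (v $ None)\<^sup>2
          + p (q t $ None) \<bullet> fibre_part \<alpha> + v $ None * (p' \<bullet> fibre_part v))) (at t)"
    by (rule DERIV_cong) (simp add: v_def algebra_simps power2_eq_square)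
  have "((\<lambda>s. G *v fibre_part (velocity q s)) has_vector_derivative G *v fibre_part \<alpha>) (at t)"
    by (rule bounded_linear.has_vector_derivative[OF matrix_vector_mul_bounded_linear y])
  from has_vector_derivative_add[OF has_vector_derivative_scaleR[OF w p] this]
  show "((\<lambda>s. velocity q s $ None *\<^sub>R p (q s $ None) + G *v fibre_part (velocity q s))
      has_vector_derivative
        (\<alpha> $ None *\<^sub>R p (q t $ None) + (v $ None)\<^sup>2 *\<^sub>R p' + G *v fibre_part \<alpha>)) (at t)"
    by (simp add: v_def algebra_simps power2_eq_square)
qed

lemma momentum_rate_Some:
  fixes q :: "real \<Rightarrow> real^('n::finite option)"
  assumes "transpose G = G"
    and "q differentiable (at t)" and "velocity q differentiable (at t)"
    and "(p has_vector_derivative p') (at (q t $ None))"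
  defines "\<alpha> \<equiv> vector_derivative (velocity q) (at t)"
  shows "momentum_rate (mech_lagrangian \<kappa> p G W) q (Some a) t =
    (\<alpha> $ None *\<^sub>R p (q t $ None) + (velocity q t $ None)\<^sup>2 *\<^sub>R p' + G *v fibre_part \<alpha>) $ a"
proof -
  have "((\<lambda>s. (velocity q s $ None *\<^sub>R p (q s $ None) + G *v fibre_part (velocity q s)) $ a)
      has_vector_derivative
        (\<alpha> $ None *\<^sub>R p (q t $ None) + (velocity q t $ None)\<^sup>2 *\<^sub>R p'
          + G *v fibre_part \<alpha>) $ a) (at t)"
    unfolding \<alpha>_def
    by (rule bounded_linear.has_vector_derivative[OF bounded_linear_vec_nth
          momentum_derivatives(2)[OF assms(2,3) DERIV_const assms(4)]])
  then have "deriv (\<lambda>s. (velocity q s $ None *\<^sub>R p (q s $ None) + G *v fibre_part (velocity q s)) $ a) t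
      = (\<alpha> $ None *\<^sub>R p (q t $ None) + (velocity q t $ None)\<^sup>2 *\<^sub>R p' + G *v fibre_part \<alpha>) $ a"
    by (intro DERIV_imp_deriv) (simp only: has_real_derivative_iff_has_vector_derivative)
  then show ?thesis
    unfolding momentum_rate_def partial_velocity_Some[OF assms(1)]
    by (simp add: mult.commute)
qed

lemma euler_lagrange_Some:
  "euler_lagrange (mech_lagrangian \<kappa> p G W) q (Some a) t
    = momentum_rate (mech_lagrangian \<kappa> p G W) q (Some a) t"
  by (simp add: euler_lagrange_def partial_position_Some)

text \<open>
  The term \<open>x' p' \<bullet> \<theta>'\<close> occurs both in the momentum rate and in the position derivative and cancels;
  half of \<open>\<kappa>' x'\<^sup>2\<close> survives.
\<close>

lemma euler_lagrange_None:
  fixes q :: "real \<Rightarrow> real^('n::finite option)"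
  assumes "q differentiable (at t)" and "velocity q differentiable (at t)"
    and "(\<kappa> has_real_derivative \<kappa>') (at (q t $ None))"
    and "(p has_vector_derivative p') (at (q t $ None))"
    and "(W has_real_derivative W') (at (q t $ None))"
  defines "\<alpha> \<equiv> vector_derivative (velocity q) (at t)"
  shows "euler_lagrange (mech_lagrangian \<kappa> p G W) q None t =
    \<kappa> (q t $ None) * \<alpha> $ None + 1/2 * \<kappa>' * (velocity q t $ None)\<^sup>2
      + p (q t $ None) \<bullet> fibre_part \<alpha> + W'"
  unfolding euler_lagrange_def momentum_rate_def partial_velocity_None
    partial_position_None[OF assms(3-5)] DERIV_imp_deriv[OF momentum_derivatives(1)[OF assms(1-4)]]
  by (simp add: \<alpha>_def)

text \<open>
  The control is minus the rate of the momentum \<open>x' G \<tau>\<close>, which is the angular momentum of a mechanical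
  Lagrangian with coupling \<open>G \<tau>\<close> and angular block \<open>0\<close>.
\<close>

lemma control_eq:
  fixes q :: "real \<Rightarrow> real^('n::finite option)"
  assumes "q differentiable (at t)" and "velocity q differentiable (at t)"
    and "(\<tau> has_vector_derivative \<tau>') (at (q t $ None))"
  defines "\<alpha> \<equiv> vector_derivative (velocity q) (at t)"
  shows "control G \<tau> q a t =
    - (\<alpha> $ None *\<^sub>R (G *v \<tau> (q t $ None)) + (velocity q t $ None)\<^sup>2 *\<^sub>R (G *v \<tau>')) $ a"
proof -
  have "((\<lambda>x. G *v \<tau> x) has_vector_derivative G *v \<tau>') (at (q t $ None))"
    by (rule bounded_linear.has_vector_derivative[OF matrix_vector_mul_bounded_linear assms(3)])
  from bounded_linear.has_vector_derivative[OF bounded_linear_vec_nth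
      momentum_derivatives(2)[OF assms(1,2) DERIV_const this, where G = 0], of a]
  have "deriv (\<lambda>s. velocity q s $ None * (G *v \<tau> (q s $ None)) $ a) t
      = (\<alpha> $ None *\<^sub>R (G *v \<tau> (q t $ None)) + (velocity q t $ None)\<^sup>2 *\<^sub>R (G *v \<tau>')) $ a"
    by (intro DERIV_imp_deriv)
      (simp add: has_real_derivative_iff_has_vector_derivative \<alpha>_def)
  then show ?thesis
    by (simp add: control_def matrix_vector_mult_def sum_distrib_left mult_ac)
qed

section \<open>Matching the two systems\<close>

text \<open>
  The coefficient of \<open>x'\<^sup>2/2\<close> in the controlled kinetic energy.
\<close>

definition shaped_inertia ::
    "(real \<Rightarrow> real) \<Rightarrow> (real \<Rightarrow> real^'n::finite) \<Rightarrow> real^'n^'n \<Rightarrow> real \<Rightarrow> (real \<Rightarrow> real^'n) \<Rightarrow> real \<Rightarrow> real"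
  where "shaped_inertia g11 g1 G \<sigma> \<tau> x =
    g11 x + 2 * (g1 x \<bullet> \<tau> x) + (1 + \<sigma>) * (\<tau> x \<bullet> (G *v \<tau> x))"

text \<open>
  Shaping by \<open>\<tau>\<close> and \<open>\<sigma>\<close> changes the inertia of \<open>x\<close> and its coupling to the angles, but leads to a
  Lagrangian of the original type, so the Euler--Lagrange expressions computed above apply to it too.
\<close>

lemma controlled_lagrangian_eq_mech_lagrangian:
  "controlled_lagrangian g11 g1 G \<sigma> \<tau> (\<lambda>q. W (q $ None))
    = mech_lagrangian (shaped_inertia g11 g1 G \<sigma> \<tau>) (\<lambda>x. g1 x + G *v \<tau> x) G W"
  unfolding fun_eq_iff controlled_lagrangian_def controlled_kinetic_def mech_lagrangian_def
    shaped_inertia_def Let_def sum_sum_matrix[symmetric]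
  by (simp add: inner_vec_def matrix_vector_mult_def)

lemma controlled_kinetic_eq_mech_lagrangian:
  "controlled_kinetic g11 g1 G \<sigma> \<tau>
    = mech_lagrangian (shaped_inertia g11 g1 G \<sigma> \<tau>) (\<lambda>x. g1 x + G *v \<tau> x) G (\<lambda>x. 0)"
  unfolding controlled_lagrangian_eq_mech_lagrangian[symmetric]
  by (simp add: fun_eq_iff controlled_lagrangian_def)

text \<open>
  Index sums become inner products, and the coefficients of \<open>\<tau>'\<close> and \<open>\<tau>\<close> are seen to be those of \<open>x''\<close> and
  \<open>x'\<^sup>2\<close> in the reduced closed-loop equation.
\<close>

lemma matching_ode_lhs:
  fixes g1 \<tau> :: "real \<Rightarrow> real^'n::finite"
  assumes "(g1 has_vector_derivative b') (at x)" and "(\<tau> has_vector_derivative \<tau>') (at x)"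
  shows "2 * \<tau> x $ a * (\<Sum>e\<in>UNIV. \<Sum>c\<in>UNIV. g1 x $ e * matrix_inv G $ e $ c * deriv (\<lambda>y. g1 y $ c) x)
        + 2 * \<tau> x $ a * (\<Sum>e\<in>UNIV. g1 x $ e * deriv (\<lambda>y. \<tau> y $ e) x)
        - \<tau> x $ a * g'
        + 2 * g11 x * deriv (\<lambda>y. \<tau> y $ a) x
        - 2 * (\<Sum>c\<in>UNIV. \<Sum>d\<in>UNIV. g1 x $ c * matrix_inv G $ d $ c * g1 x $ d)
            * deriv (\<lambda>y. \<tau> y $ a) x
        - 2 * (\<Sum>c\<in>UNIV. g1 x $ c * \<tau> x $ c) * deriv (\<lambda>y. \<tau> y $ a) x
    = 2 * ((g11 x - g1 x \<bullet> (matrix_inv G *v g1 x) - g1 x \<bullet> \<tau> x) * \<tau>' $ a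
        - (1/2 * g' - g1 x \<bullet> (matrix_inv G *v b') - g1 x \<bullet> \<tau>') * \<tau> x $ a)"
proof -
  have d: "deriv (\<lambda>y. f y $ c) x = f' $ c"
    if "(f has_vector_derivative f') (at x)" for f :: "real \<Rightarrow> real^'n" and f' c
    using bounded_linear.has_vector_derivative[OF bounded_linear_vec_nth that, of c]
    by (intro DERIV_imp_deriv) (simp add: has_real_derivative_iff_has_vector_derivative)
  have s: "(\<Sum>e\<in>UNIV. \<Sum>c\<in>UNIV. u $ e * M $ e $ c * v $ c) = u \<bullet> (M *v v)"
    for u v :: "real^'n" and M
    using sum_sum_matrix[of M u v] by (simp add: mult_ac)
  have s': "(\<Sum>c\<in>UNIV. \<Sum>d\<in>UNIV. u $ c * M $ d $ c * u $ d) = u \<bullet> (M *v u)"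
    for u :: "real^'n" and M
    by (subst sum.swap, subst s[symmetric]) (simp add: mult_ac)
  have i: "(\<Sum>c\<in>UNIV. u $ c * v $ c) = u \<bullet> v" for u v :: "real^'n"
    by (simp add: inner_vec_def)
  show ?thesis
    unfolding d[OF assms(1)] d[OF assms(2)] s s' i by (simp add: algebra_simps)
qed

text \<open>
  The algebraic core. Here \<open>\<omega> = x''\<close>, \<open>w = x'\<close>, \<open>y = \<theta>''\<close>, and \<open>c, b, \<tau>\<close> and their primed versions are
  the values and derivatives of the coefficients at one point. Eliminating \<open>y\<close> by the \<open>\<theta>\<close>-equation turns
  the kinetic parts of the two \<open>x\<close>-equations into \<open>A \<omega> + B w\<^sup>2\<close> and \<open>D \<omega> + E w\<^sup>2\<close>. Since \<open>D - A\<close>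
  is built from \<open>\<tau>\<close> as \<open>E - B\<close> is from \<open>\<tau>'\<close>, the vector equation \<open>A \<tau>' = B \<tau>\<close> yields \<open>A E = D B\<close>.
\<close>

lemma reduced_equations_proportional:
  fixes G :: "real^'n::finite^'n" and b b' \<tau> \<tau>' y :: "real^'n"
    and c c' \<sigma> \<omega> w V' W' :: real
  assumes "transpose G = G" and "invertible G"
    and fibre: "\<omega> *\<^sub>R (b + G *v \<tau>) + w\<^sup>2 *\<^sub>R (b' + G *v \<tau>') + G *v y = 0"
  defines "A \<equiv> c - b \<bullet> (matrix_inv G *v b) - b \<bullet> \<tau>"
    and "B \<equiv> 1/2 * c' - b \<bullet> (matrix_inv G *v b') - b \<bullet> \<tau>'"
    and "D \<equiv> c - b \<bullet> (matrix_inv G *v b) + \<sigma> * (\<tau> \<bullet> (G *v \<tau>))"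
  assumes ode: "A *\<^sub>R \<tau>' = B *\<^sub>R \<tau>"
    and pot: "A * W' = D * V'"
  shows "A * ((c + 2 * (b \<bullet> \<tau>) + (1 + \<sigma>) * (\<tau> \<bullet> (G *v \<tau>))) * \<omega>
        + 1/2 * (c' + 2 * (b' \<bullet> \<tau> + b \<bullet> \<tau>') + 2 * (1 + \<sigma>) * (\<tau> \<bullet> (G *v \<tau>'))) * w\<^sup>2
        + (b + G *v \<tau>) \<bullet> y + W')
    = D * (c * \<omega> + 1/2 * c' * w\<^sup>2 + b \<bullet> y + V')"
proof -
  let ?H = "matrix_inv G"
  note HG = matrix_inv_cancel_left[OF assms(2)]
  have Gy: "G *v y = - (\<omega> *\<^sub>R (b + G *v \<tau>) + w\<^sup>2 *\<^sub>R (b' + G *v \<tau>'))"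
    unfolding eq_neg_iff_add_eq_0 using fibre by (simp add: add_ac)
  have y: "y = - (\<omega> *\<^sub>R (?H *v b + \<tau>) + w\<^sup>2 *\<^sub>R (?H *v b' + \<tau>'))"
    using arg_cong[OF Gy, of "\<lambda>u. ?H *v u"]
    by (simp add: HG matrix_vector_mult_minus_right matrix_vector_right_distrib
        matrix_vector_mult_scaleR del: minus_add_distrib)
  have inner_y: "b \<bullet> y = - (\<omega> * (b \<bullet> (?H *v b) + b \<bullet> \<tau>) + w\<^sup>2 * (b \<bullet> (?H *v b') + b \<bullet> \<tau>'))"
    by (subst y) (simp add: inner_add_right algebra_simps)
  have inner_G\<tau>_y: "(G *v \<tau>) \<bullet> y = - (\<omega> * (b \<bullet> \<tau> + \<tau> \<bullet> (G *v \<tau>)) + w\<^sup>2 * (b' \<bullet> \<tau> + \<tau> \<bullet> (G *v \<tau>')))"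
    unfolding inner_symmetric_matrix[OF assms(1), symmetric] Gy
    by (simp add: inner_add_right inner_commute[of \<tau>] algebra_simps)
  have o1: "A * (b \<bullet> \<tau>') = B * (b \<bullet> \<tau>)"
    using arg_cong[OF ode, of "\<lambda>u. b \<bullet> u"] by simp
  have o2: "A * (\<tau> \<bullet> (G *v \<tau>')) = B * (\<tau> \<bullet> (G *v \<tau>))"
    using arg_cong[OF ode, of "\<lambda>u. \<tau> \<bullet> (G *v u)"] by (simp add: matrix_vector_mult_scaleR)
  have DA: "D = A + b \<bullet> \<tau> + \<sigma> * (\<tau> \<bullet> (G *v \<tau>))"
    by (simp add: D_def A_def)
  have l: "(c + 2 * (b \<bullet> \<tau>) + (1 + \<sigma>) * (\<tau> \<bullet> (G *v \<tau>))) * \<omega>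
        + 1/2 * (c' + 2 * (b' \<bullet> \<tau> + b \<bullet> \<tau>') + 2 * (1 + \<sigma>) * (\<tau> \<bullet> (G *v \<tau>'))) * w\<^sup>2
        + (b + G *v \<tau>) \<bullet> y
      = D * \<omega> + (B + b \<bullet> \<tau>' + \<sigma> * (\<tau> \<bullet> (G *v \<tau>'))) * w\<^sup>2"
    unfolding inner_add_left inner_y inner_G\<tau>_y D_def B_def by (simp add: algebra_simps)
  have r: "c * \<omega> + 1/2 * c' * w\<^sup>2 + b \<bullet> y = A * \<omega> + B * w\<^sup>2"
    unfolding inner_y A_def B_def by (simp add: algebra_simps)
  define E where "E = B + b \<bullet> \<tau>' + \<sigma> * (\<tau> \<bullet> (G *v \<tau>'))"
  have AE: "A * E = B * D"
    using o1 o2 unfolding DA E_def by (simp add: algebra_simps)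
  have "A * (D * \<omega> + E * w\<^sup>2) = A * D * \<omega> + (A * E) * w\<^sup>2"
    by (simp add: algebra_simps)
  then have "A * (D * \<omega> + E * w\<^sup>2) = D * (A * \<omega> + B * w\<^sup>2)"
    unfolding AE by (simp add: algebra_simps)
  then show ?thesis
    unfolding l r E_def[symmetric] using pot by (simp add: algebra_simps)
qed

lemma shaped_inertia_derivative:
  fixes g1 \<tau> :: "real \<Rightarrow> real^'n::finite"
  assumes "transpose G = G"
    and "(g11 has_real_derivative c') (at x)"
    and "(g1 has_vector_derivative b') (at x)" and "(\<tau> has_vector_derivative \<tau>') (at x)"
  shows "(shaped_inertia g11 g1 G \<sigma> \<tau> has_real_derivative
    c' + 2 * (b' \<bullet> \<tau> x + g1 x \<bullet> \<tau>') + 2 * (1 + \<sigma>) * (\<tau> x \<bullet> (G *v \<tau>'))) (at x)"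
proof -
  have "((\<lambda>x. g1 x \<bullet> \<tau> x) has_real_derivative g1 x \<bullet> \<tau>' + b' \<bullet> \<tau> x) (at x)"
    using bounded_bilinear.has_vector_derivative[OF bounded_bilinear_inner assms(3,4)]
    by (simp add: has_real_derivative_iff_has_vector_derivative)
  moreover have "((\<lambda>x. \<tau> x \<bullet> (G *v \<tau> x)) has_real_derivative 2 * (\<tau> x \<bullet> (G *v \<tau>'))) (at x)"
  proof -
    have "\<tau>' \<bullet> (G *v \<tau> x) = \<tau> x \<bullet> (G *v \<tau>')"
      using inner_symmetric_matrix[OF assms(1), of "\<tau>'" "\<tau> x"] by (simp add: inner_commute)
    then show ?thesis
      using bounded_bilinear.has_vector_derivative[OF bounded_bilinear_inner assms(4)
          bounded_linear.has_vector_derivative[OF matrix_vector_mul_bounded_linear assms(4), of G]]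
      by (simp add: has_real_derivative_iff_has_vector_derivative)
  qed
  ultimately show ?thesis
    unfolding shaped_inertia_def [abs_def] using assms(2)
    by (auto intro!: derivative_eq_intros simp: algebra_simps)
qed

text \<open>
  The comparison at a single instant. The angular equations of both systems say that one and the same
  vector \<open>Z\<close> vanishes; where it does, the two \<open>x\<close>-equations differ by the nonzero factor \<open>D/A\<close>.
\<close>

lemma equations_of_motion_equivalent:
  fixes q :: "real \<Rightarrow> real^('n::finite option)" and \<tau>' :: "real^'n"
  assumes "transpose G = G" and "invertible G"
    and "q differentiable (at t)" and "velocity q differentiable (at t)"
    and g11: "(g11 has_real_derivative c') (at (q t $ None))"
    and g1: "(g1 has_vector_derivative b') (at (q t $ None))"
    and \<tau>: "(\<tau> has_vector_derivative \<tau>') (at (q t $ None))"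
    and V: "(V has_real_derivative V') (at (q t $ None))"
    and W: "(W has_real_derivative D / A * V') (at (q t $ None))"
    and A_def: "A = g11 (q t $ None) - g1 (q t $ None) \<bullet> (matrix_inv G *v g1 (q t $ None))
        - g1 (q t $ None) \<bullet> \<tau> (q t $ None)"
    and B_def: "B = 1/2 * c' - g1 (q t $ None) \<bullet> (matrix_inv G *v b') - g1 (q t $ None) \<bullet> \<tau>'"
    and D_def: "D = g11 (q t $ None) - g1 (q t $ None) \<bullet> (matrix_inv G *v g1 (q t $ None))
        + \<sigma> * (\<tau> (q t $ None) \<bullet> (G *v \<tau> (q t $ None)))"
    and ode: "A *\<^sub>R \<tau>' = B *\<^sub>R \<tau> (q t $ None)"
    and "A \<noteq> 0" and "D \<noteq> 0"
  shows "(\<forall>i. euler_lagrange (controlled_lagrangian g11 g1 G \<sigma> \<tau> (\<lambda>r. W (r $ None))) q i t = 0)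
    \<longleftrightarrow> euler_lagrange (mech_lagrangian g11 g1 G V) q None t = 0
      \<and> (\<forall>a. momentum_rate (mech_lagrangian g11 g1 G V) q (Some a) t = control G \<tau> q a t)"
proof -
  let ?x = "q t $ None" and ?w = "velocity q t $ None"
  define \<alpha> where "\<alpha> = vector_derivative (velocity q) (at t)"
  let ?\<kappa> = "shaped_inertia g11 g1 G \<sigma> \<tau>" and ?p = "\<lambda>x. g1 x + G *v \<tau> x"
  have p: "(?p has_vector_derivative b' + G *v \<tau>') (at ?x)"
    by (intro has_vector_derivative_add g1
        bounded_linear.has_vector_derivative[OF matrix_vector_mul_bounded_linear \<tau>])
  define Z where "Z = \<alpha> $ None *\<^sub>R (g1 ?x + G *v \<tau> ?x) + ?w\<^sup>2 *\<^sub>R (b' + G *v \<tau>') + G *v fibre_part \<alpha>"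
  define EL where "EL = euler_lagrange (mech_lagrangian ?\<kappa> ?p G W) q None t"
  define ELc where "ELc = euler_lagrange (mech_lagrangian g11 g1 G V) q None t"
  have EL: "EL = (g11 ?x + 2 * (g1 ?x \<bullet> \<tau> ?x) + (1 + \<sigma>) * (\<tau> ?x \<bullet> (G *v \<tau> ?x))) * \<alpha> $ None
      + 1/2 * (c' + 2 * (b' \<bullet> \<tau> ?x + g1 ?x \<bullet> \<tau>') + 2 * (1 + \<sigma>) * (\<tau> ?x \<bullet> (G *v \<tau>'))) * ?w\<^sup>2
      + (g1 ?x + G *v \<tau> ?x) \<bullet> fibre_part \<alpha> + D / A * V'"
    unfolding EL_def \<alpha>_def
      euler_lagrange_None[OF assms(3,4) shaped_inertia_derivative[OF assms(1) g11 g1 \<tau>] p W]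
    by (simp add: shaped_inertia_def)
  have ELc: "ELc = g11 ?x * \<alpha> $ None + 1/2 * c' * ?w\<^sup>2 + g1 ?x \<bullet> fibre_part \<alpha> + V'"
    unfolding ELc_def \<alpha>_def euler_lagrange_None[OF assms(3,4) g11 g1 V] ..
  have "A * EL = D * ELc" if "Z = 0"
    unfolding EL ELc A_def D_def
  proof (rule reduced_equations_proportional[OF assms(1,2)])
    show "\<alpha> $ None *\<^sub>R (g1 ?x + G *v \<tau> ?x) + ?w\<^sup>2 *\<^sub>R (b' + G *v \<tau>') + G *v fibre_part \<alpha> = 0"
      using that by (simp add: Z_def)
  qed (use ode \<open>A \<noteq> 0\<close> in \<open>simp_all add: A_def B_def D_def\<close>)
  then have base: "Z = 0 \<Longrightarrow> EL = 0 \<longleftrightarrow> ELc = 0"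
    using \<open>A \<noteq> 0\<close> \<open>D \<noteq> 0\<close> by (metis mult_eq_0_iff)
  have "euler_lagrange (mech_lagrangian ?\<kappa> ?p G W) q (Some a) t = Z $ a" for a
    unfolding euler_lagrange_Some momentum_rate_Some[OF assms(1,3,4) p] Z_def \<alpha>_def ..
  moreover have "momentum_rate (mech_lagrangian g11 g1 G V) q (Some a) t = control G \<tau> q a t
      \<longleftrightarrow> Z $ a = 0" for a
    unfolding momentum_rate_Some[OF assms(1,3,4) g1] control_eq[OF assms(3,4) \<tau>] Z_def \<alpha>_def
    by (auto simp: algebra_simps)
  ultimately show ?thesis
    unfolding controlled_lagrangian_eq_mech_lagrangian split_option_all EL_def[symmetric]
      ELc_def[symmetric]
    using base by (auto simp: vec_eq_iff)
qed

lemma open_chart: "open I \<Longrightarrow> open (chart I)"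
  unfolding chart_def using open_vimage_vec_nth[of I None] by (simp add: vimage_def)

lemma matching_ode_iff:
  fixes g1 \<tau> :: "real \<Rightarrow> real^'n::finite"
  assumes "smooth_on I g1"
  shows "matching_ode_solution I g11 g1 G \<tau> \<longleftrightarrow> smooth_on I \<tau> \<and>
    (\<forall>x\<in>I. (g11 x - g1 x \<bullet> (matrix_inv G *v g1 x) - g1 x \<bullet> \<tau> x) *\<^sub>R vector_derivative \<tau> (at x)
      = (1/2 * deriv g11 x - g1 x \<bullet> (matrix_inv G *v vector_derivative g1 (at x))
          - g1 x \<bullet> vector_derivative \<tau> (at x)) *\<^sub>R \<tau> x)"
  unfolding matching_ode_solution_def
  by (intro conj_cong refl ball_cong)
    (simp add: vec_eq_iff matching_ode_lhs[OF smooth_on_has_vector_derivative[OF assms]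
        smooth_on_has_vector_derivative])

text \<open>
  The potential is the pullback to the chart of an antiderivative of \<open>(D/A) V'\<close>. The closed-loop
  assumption makes this quotient smooth on \<open>I\<close>; regularity of the controlled Lagrangian makes \<open>D\<close> nonzero,
  without which its Euler-Lagrange equations could have more solutions than the controlled system.
\<close>

lemma shaped_potential_exists:
  fixes g11 V :: "real \<Rightarrow> real" and g1 \<tau> :: "real \<Rightarrow> real^'n::finite" and G :: "real^'n^'n"
  assumes I: "open I" "is_interval I"
    and smooth: "smooth_on I g11" "smooth_on I g1" "smooth_on I V"
    and pd: "\<forall>x\<in>I. pos_def_matrix (metric_matrix g11 g1 G x)"
    and ode: "matching_ode_solution I g11 g1 G \<tau>"
    and closed_loop: "\<forall>x\<in>I. invertible (closed_loop_matrix g11 g1 G \<tau> x)"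
    and regular: "\<forall>q\<in>chart I. \<forall>v. invertible (hessian (controlled_kinetic g11 g1 G \<sigma> \<tau> q) v)"
  shows "\<exists>Vt. smooth_on (chart I) Vt \<and>
    (\<forall>J q. euler_lagrange_solution (chart I) (controlled_lagrangian g11 g1 G \<sigma> \<tau> Vt) J q
      \<longleftrightarrow> controlled_euler_lagrange_solution (chart I) (mech_lagrangian g11 g1 G V) G \<tau> J q)"
proof -
  let ?H = "matrix_inv G"
  have sym: "transpose G = G" and inv: "invertible G" if "x \<in> I" for x
    using pos_def_block[of "g11 x" "g1 x" "g1 x" G] pd that by (auto simp: metric_matrix_def)
  have \<tau>: "smooth_on I \<tau>" using ode by (simp add: matching_ode_solution_def)
  define A where "A x = g11 x - g1 x \<bullet> (?H *v g1 x) - g1 x \<bullet> \<tau> x" for x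
  define D where "D x = g11 x - g1 x \<bullet> (?H *v g1 x) + \<sigma> * (\<tau> x \<bullet> (G *v \<tau> x))" for x
  have HG: "?H *v (G *v u) = u" if "x \<in> I" for x u
    using matrix_inv_cancel_left[OF inv[OF that]] .
  have A0: "A x \<noteq> 0" if x: "x \<in> I" for x
    using schur_complement_nonzero[OF inv[OF x], of "g11 x" "g1 x" "g1 x + G *v \<tau> x"] closed_loop x
    by (simp add: closed_loop_matrix_def A_def matrix_vector_right_distrib inner_add_right HG[OF x])
  have D0: "D x \<noteq> 0" if x: "x \<in> I" for x
  proof -
    \<comment> \<open>Any configuration over \<open>x\<close> will do, as the Hessian depends on \<open>x\<close> only.\<close>
    define r :: "real^('n option)" where "r = axis None x"
    have r: "r $ None = x" by (simp add: r_def)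
    then have "r \<in> chart I" using x by (simp add: chart_def)
    then have "invertible (hessian (controlled_kinetic g11 g1 G \<sigma> \<tau> r) 0)"
      using regular by blast
    then have "shaped_inertia g11 g1 G \<sigma> \<tau> x
        - (g1 x + G *v \<tau> x) \<bullet> (?H *v (g1 x + G *v \<tau> x)) \<noteq> 0"
      unfolding controlled_kinetic_eq_mech_lagrangian hessian_mech_lagrangian[OF sym[OF x]]
        metric_matrix_def r
      by (rule schur_complement_nonzero[OF inv[OF x]])
    moreover have "(G *v \<tau> x) \<bullet> (?H *v g1 x) = g1 x \<bullet> \<tau> x"
      using inner_symmetric_matrix[OF sym[OF x], of "\<tau> x" "?H *v g1 x"]
      by (simp add: matrix_inv_cancel_right[OF inv[OF x]] inner_commute)
    ultimately show ?thesis
      by (simp add: D_def shaped_inertia_def matrix_vector_right_distrib inner_add_right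
          inner_add_left HG[OF x] algebra_simps inner_commute)
  qed
  have W_smooth: "smooth_on I (\<lambda>x. D x / A x * deriv V x)"
    using A0 unfolding A_def D_def
    by (intro smooth_on_mult smooth_on_divide smooth_on_diff smooth_on_add smooth_on_inner
        smooth_on_matrix_vector_mult smooth_on_const smooth_on_deriv smooth \<tau> I(1)) auto
  obtain W where W: "(W has_real_derivative D x / A x * deriv V x) (at x)" if "x \<in> I" for x
    using open_interval_antiderivative[OF I smooth_on_imp_continuous[OF W_smooth]] by blast
  have "smooth_on (chart I) (\<lambda>r. W (r $ None))"
    by (rule smooth_on_compose_real[OF open_chart[OF I(1)]
          smooth_on_antiderivative[OF I(1) W W_smooth] smooth_on_vec_nth[OF open_chart[OF I(1)]]])
      (auto simp: chart_def)
  moreover have "euler_lagrange_solution (chart I)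
        (controlled_lagrangian g11 g1 G \<sigma> \<tau> (\<lambda>r. W (r $ None))) J q
      \<longleftrightarrow> controlled_euler_lagrange_solution (chart I) (mech_lagrangian g11 g1 G V) G \<tau> J q" for J q
    unfolding euler_lagrange_solution_def controlled_euler_lagrange_solution_def
  proof (intro conj_cong refl ball_cong)
    fix t assume "admissible_curve (chart I) J q" and "t \<in> J"
    then have x: "q t $ None \<in> I" and q: "q differentiable (at t)" "velocity q differentiable (at t)"
      by (auto simp: admissible_curve_def chart_def)
    show "(\<forall>i. euler_lagrange (controlled_lagrangian g11 g1 G \<sigma> \<tau> (\<lambda>r. W (r $ None))) q i t = 0)
      \<longleftrightarrow> euler_lagrange (mech_lagrangian g11 g1 G V) q None t = 0
        \<and> (\<forall>a. momentum_rate (mech_lagrangian g11 g1 G V) q (Some a) t = control G \<tau> q a t)"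
      by (rule equations_of_motion_equivalent[OF sym[OF x] inv[OF x] q
            smooth_on_real_has_derivative[OF smooth(1) x] smooth_on_has_vector_derivative[OF smooth(2) x]
            smooth_on_has_vector_derivative[OF \<tau> x] smooth_on_real_has_derivative[OF smooth(3) x]
            W[OF x] A_def refl D_def _ A0[OF x] D0[OF x]])
        (use ode x in \<open>simp add: matching_ode_iff[OF smooth(2)] A_def\<close>)
  qed
  ultimately show ?thesis by blast
qed

text \<open>
  Positive definiteness makes \<open>\<delta> = g11 G - g1\<^sup>2\<close>, the determinant of the metric, positive, so that the
  square root is smooth. With \<open>\<gamma>\<close> the single entry of \<open>G\<close>, the ODE is \<open>\<delta> \<tau>' = \<delta>' \<tau>/2\<close> divided by
  \<open>\<gamma>\<close>, up to a term \<open>g1 \<tau> \<tau>'\<close> that is common to both sides.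
\<close>

lemma matching_ode_two_dimensional:
  fixes g11 :: "real \<Rightarrow> real" and g1 :: "real \<Rightarrow> real^'n::finite" and G :: "real^'n^'n"
  assumes "open I" and g11: "smooth_on I g11" and g1: "smooth_on I g1"
    and pd: "\<forall>x\<in>I. pos_def_matrix (metric_matrix g11 g1 G x)"
    and "CARD('n) = 1"
  shows "matching_ode_solution I g11 g1 G (\<lambda>x. \<chi> a. k * sqrt (g11 x * G $ a $ a - (g1 x $ a)\<^sup>2))"
proof -
  let ?H = "matrix_inv G"
  obtain a :: 'n where univ: "UNIV = {a}"
    using assms(5) card_1_singletonE by blast
  have idx: "b = a" for b :: 'n using univ by auto
  have ext1: "u = v" if "u $ a = v $ a" for u v :: "real^'n"
    unfolding vec_eq_iff using that idx by metis
  have inner: "u \<bullet> v = u $ a * v $ a" for u v :: "real^'n"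
    by (simp add: inner_vec_def univ)
  have mult: "(M *v v) $ a = M $ a $ a * v $ a" for M :: "real^'n^'n" and v
    by (simp add: matrix_vector_mult_def univ)
  define \<gamma> where "\<gamma> = G $ a $ a"
  define \<delta> where "\<delta> x = g11 x * \<gamma> - (g1 x $ a)\<^sup>2" for x
  define \<tau> where "\<tau> x = (k * sqrt (\<delta> x)) *\<^sub>R (axis a 1 :: real^'n)" for x
  have \<tau>_eq: "(\<lambda>x. \<chi> a. k * sqrt (g11 x * G $ a $ a - (g1 x $ a)\<^sup>2)) = \<tau>"
  proof (intro ext iffD2[OF vec_eq_iff] allI)
    fix x and b :: 'n
    have "b = a" by (rule idx)
    then show "(\<chi> a. k * sqrt (g11 x * G $ a $ a - (g1 x $ a)\<^sup>2)) $ b = \<tau> x $ b"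
      by (simp add: \<tau>_def \<delta>_def \<gamma>_def)
  qed
  have \<tau>_nth: "\<tau> x $ a = k * sqrt (\<delta> x)" for x
    by (simp add: \<tau>_def)
  have \<gamma>_pos: "\<gamma> > 0" if "x \<in> I" for x
  proof -
    have "axis a 1 \<bullet> (G *v axis a 1) > 0"
      using pd that by (intro pos_def_block(2)[of "g11 x" "g1 x" "g1 x" G])
        (auto simp: metric_matrix_def axis_eq_0_iff)
    then show ?thesis by (simp add: inner mult \<gamma>_def)
  qed
  have \<delta>_pos: "\<delta> x > 0" if x: "x \<in> I" for x
  proof -
    let ?B = "block_matrix (g11 x) (g1 x) (g1 x) G"
    \<comment> \<open>The form \<open>v \<bullet> B v\<close> at this vector is \<open>\<gamma>\<close> times the determinant.\<close>
    define v :: "real^('n option)" where "v = (\<chi> i. case i of None \<Rightarrow> \<gamma> | Some b \<Rightarrow> - g1 x $ a)"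
    have v: "v $ None = \<gamma>" "v $ Some a = - g1 x $ a" by (simp_all add: v_def)
    then have "v \<noteq> 0" using \<gamma>_pos[OF x] by auto
    then have "v \<bullet> (?B *v v) > 0"
      using pd x by (simp add: pos_def_matrix_def metric_matrix_def)
    also have "v \<bullet> (?B *v v) = \<gamma> * \<delta> x"
      by (simp add: inner_option block_matrix_mult_None fibre_part_block_matrix_mult inner mult v
          \<delta>_def \<gamma>_def[symmetric] del: fibre_part_nth)
        (simp add: v algebra_simps power2_eq_square)
    finally show ?thesis using \<gamma>_pos[OF x] by (simp add: zero_less_mult_iff)
  qed
  have \<delta>_smooth: "smooth_on I \<delta>"
    unfolding \<delta>_def [abs_def] power2_eq_square
    by (intro smooth_on_diff smooth_on_mult smooth_on_const g11 assms(1)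
        smooth_on_bounded_linear[OF bounded_linear_vec_nth] g1)
  have "smooth_on I (\<lambda>x. k * sqrt (\<delta> x))"
    by (intro smooth_on_mult smooth_on_const smooth_on_sqrt assms(1) \<delta>_smooth \<delta>_pos)
  then have \<tau>_smooth: "smooth_on I \<tau>"
    unfolding \<tau>_def [abs_def]
    by (rule smooth_on_bounded_linear[OF bounded_linear_scaleR_left assms(1)])
  have "(g11 x - g1 x \<bullet> (?H *v g1 x) - g1 x \<bullet> \<tau> x) *\<^sub>R vector_derivative \<tau> (at x)
      = (1/2 * deriv g11 x - g1 x \<bullet> (?H *v vector_derivative g1 (at x))
          - g1 x \<bullet> vector_derivative \<tau> (at x)) *\<^sub>R \<tau> x" if x: "x \<in> I" for x
  proof -
    define b' where "b' = vector_derivative g1 (at x) $ a"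
    define \<delta>' where "\<delta>' = \<gamma> * deriv g11 x - 2 * g1 x $ a * b'"
    have "((\<lambda>y. g1 y $ a) has_real_derivative b') (at x)"
      unfolding has_real_derivative_iff_has_vector_derivative b'_def
      by (rule bounded_linear.has_vector_derivative[OF bounded_linear_vec_nth
            smooth_on_has_vector_derivative[OF g1 x]])
    then have "(\<delta> has_real_derivative \<delta>') (at x)"
      unfolding \<delta>_def [abs_def] \<delta>'_def
      using smooth_on_real_has_derivative[OF g11 x]
      by (auto intro!: derivative_eq_intros)
    then have "((\<lambda>x. k * sqrt (\<delta> x)) has_real_derivative k * (\<delta>' / (2 * sqrt (\<delta> x)))) (at x)"
      using \<delta>_pos[OF x] by (auto intro!: derivative_eq_intros simp: field_simps)
    then have "(\<tau> has_vector_derivative (k * (\<delta>' / (2 * sqrt (\<delta> x)))) *\<^sub>R axis a 1) (at x)"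
      unfolding \<tau>_def [abs_def] has_real_derivative_iff_has_vector_derivative
      by (rule bounded_linear.has_vector_derivative[OF bounded_linear_scaleR_left])
    then have \<tau>': "vector_derivative \<tau> (at x) $ a = k * (\<delta>' / (2 * sqrt (\<delta> x)))"
      by (simp add: vector_derivative_at)
    have "\<delta> x = sqrt (\<delta> x) * sqrt (\<delta> x)" using \<delta>_pos[OF x] by simp
    then have half: "\<delta> x * vector_derivative \<tau> (at x) $ a = 1/2 * \<delta>' * \<tau> x $ a"
      unfolding \<tau>' \<tau>_nth using \<delta>_pos[OF x] by (simp add: field_simps)
    have "invertible G"
      using pos_def_block(3)[of "g11 x" "g1 x" "g1 x" G] pd x by (simp add: metric_matrix_def)
    then have H: "(?H *v v) $ a = v $ a / \<gamma>" for v
      using mult[of G "?H *v v"] matrix_inv_cancel_right[of G v] \<gamma>_pos[OF x]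
      by (simp add: \<gamma>_def field_simps)
    have A: "g11 x - g1 x $ a * (g1 x $ a / \<gamma>) = \<delta> x / \<gamma>"
      and B: "1/2 * deriv g11 x - g1 x $ a * (b' / \<gamma>) = 1/2 * \<delta>' / \<gamma>"
      using \<gamma>_pos[OF x] by (simp_all add: \<delta>_def \<delta>'_def field_simps power2_eq_square)
    have "(\<delta> x / \<gamma> - g1 x $ a * \<tau> x $ a) * vector_derivative \<tau> (at x) $ a
        = \<delta> x * vector_derivative \<tau> (at x) $ a / \<gamma>
          - g1 x $ a * \<tau> x $ a * vector_derivative \<tau> (at x) $ a"
      by (simp add: algebra_simps)
    also have "\<dots> = (1/2 * \<delta>' / \<gamma> - g1 x $ a * vector_derivative \<tau> (at x) $ a) * \<tau> x $ a"
      unfolding half by (simp add: algebra_simps)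
    finally have "(g11 x - g1 x $ a * (g1 x $ a / \<gamma>) - g1 x $ a * \<tau> x $ a)
          * vector_derivative \<tau> (at x) $ a
        = (1/2 * deriv g11 x - g1 x $ a * (b' / \<gamma>)
          - g1 x $ a * vector_derivative \<tau> (at x) $ a) * \<tau> x $ a"
      unfolding A B .
    then show ?thesis
      by (intro ext1) (simp add: inner H b'_def)
  qed
  then show ?thesis
    unfolding \<tau>_eq matching_ode_iff[OF g1] using \<tau>_smooth by blast
qed

theorem theorem3p1:
  fixes I :: "real set"
    and g11 V :: "real \<Rightarrow> real"
    and g1 :: "real \<Rightarrow> real^'n::finite"
    and G :: "real^'n^'n"
  assumes "open I" and "is_interval I"
    and "smooth_on I g11" and "smooth_on I g1" and "smooth_on I V"
    and "\<forall>x\<in>I. pos_def_matrix (metric_matrix g11 g1 G x)"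
  shows "(\<forall>(\<sigma>::real) (\<tau> :: real \<Rightarrow> real^'n).
            matching_ode_solution I g11 g1 G \<tau>
            \<and> (\<forall>x\<in>I. invertible (closed_loop_matrix g11 g1 G \<tau> x))
            \<and> (\<forall>q\<in>chart I. \<forall>v. invertible (hessian (controlled_kinetic g11 g1 G \<sigma> \<tau> q) v))
            \<longrightarrow>
            (\<exists>Vt :: real^('n option) \<Rightarrow> real.
               smooth_on (chart I) Vt \<and>
               (\<forall>J q. open J \<and> is_interval J \<longrightarrow>
                  (euler_lagrange_solution (chart I)
                     (controlled_lagrangian g11 g1 G \<sigma> \<tau> Vt) J q
                   \<longleftrightarrow>
                   controlled_euler_lagrange_solution (chart I)
                     (mech_lagrangian g11 g1 G V) G \<tau> J q))))
         \<and>
         (CARD('n option) = 2 \<longrightarrow>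
            (\<forall>k::real. matching_ode_solution I g11 g1 G
               (\<lambda>x. \<chi> a. k * sqrt (g11 x * G $ a $ a - (g1 x $ a)\<^sup>2))))"
proof (intro conjI allI impI)
  fix \<sigma> :: real and \<tau> :: "real \<Rightarrow> real^'n"
  assume "matching_ode_solution I g11 g1 G \<tau>
      \<and> (\<forall>x\<in>I. invertible (closed_loop_matrix g11 g1 G \<tau> x))
      \<and> (\<forall>q\<in>chart I. \<forall>v. invertible (hessian (controlled_kinetic g11 g1 G \<sigma> \<tau> q) v))"
  with shaped_potential_exists[OF assms, of \<tau> \<sigma>]
  show "\<exists>Vt :: real^('n option) \<Rightarrow> real.
               smooth_on (chart I) Vt \<and>
               (\<forall>J q. open J \<and> is_interval J \<longrightarrow>
                  (euler_lagrange_solution (chart I)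
                     (controlled_lagrangian g11 g1 G \<sigma> \<tau> Vt) J q
                   \<longleftrightarrow>
                   controlled_euler_lagrange_solution (chart I)
                     (mech_lagrangian g11 g1 G V) G \<tau> J q))"
    by blast
next
  fix k :: real
  assume "CARD('n option) = 2"
  then have "CARD('n) = 1" by simp
  then show "matching_ode_solution I g11 g1 G
      (\<lambda>x. \<chi> a. k * sqrt (g11 x * G $ a $ a - (g1 x $ a)\<^sup>2))"
    using matching_ode_two_dimensional assms(1,3,4,6) by blast
qed

end
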